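(* Let $\mathcal A$ be a central arrangement of hyperplanes in $\mathbb C^\ell$ with underlying matroid $G$, and let $X\in L(\mathcal A)$ be a modular element. Let $\pi:\mathbb C^\ell\to\mathbb C^\ell/X$ be the projection, let $\bar v=v+X\in(\mathbb C^\ell/X)\setminus\bigcup\mathcal A_X$, and let $\mathcal A_{\bar v}$ be the restriction of $\mathcal A$ to $\pi^{-1}(\bar v)$. Then the intersection lattice $L(c\mathcal A_{\bar v})$ is isomorphic to $L(\bar T_X(G))$, the lattice of flats of the complete principal truncation of $G$ along $\mathcal A_X$.
   Context: $L(\mathcal A)$: intersections of hyperplanes of $\mathcal A$, ordered by reverse inclusion, rank $r(X)=\operatorname{codim}X$, join $X\vee Y=X\cap Y$, meet $X\wedge Y=\bigcap\{H\in\mathcal A:H\supseteq X+Y\}$. $X$ is modular if $r(X\vee Y)+r(X\wedge Y)=r(X)+r(Y)$ for all $Y\in L(\mathcal A)$. $\mathcal A_X=\{H\in\mathcal A:H\supseteq X\}$, regarded as an arrangement in $\mathbb C^\ell/X$. The matroid $G=G(\mathcal A)$ on $\mathcal A$ has dependent sets those $\mathcal B$ with $\operatorname{codim}\bigcap\mathcal B<|\mathcal B|$; its flats correspond to elements of $L(\mathcal A)$ via $X\mapsto\mathcal A_X$. The restriction of $\mathcal A$ to an affine subspace $S$ is the arrangement of intersections $H\cap S$ that are hyperplanes of $S$. The cone $c\mathcal B$ of an affine arrangement $\mathcal B$ in $\mathbb C^m$: place $\mathcal B$ in $\{1\}\times\mathbb C^m$, take linear spans, and adjoin $\{0\}\times\mathbb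 C^m$. The complete principal truncation $\bar T_F(G)$ of $G$ along a flat $F$: add $r(F)-1$ generic points on $F$ and contract on the flat they span (then simplify). *)

theory Defs
  imports "HOL-Analysis.Analysis"
begin

text \<open>
  All linear algebra is over the complex numbers: \<open>vec.subspace\<close>, \<open>vec.span\<close>, \<open>vec.dim\<close> refer to
  the scalar multiplication \<open>(*s)\<close>, in contrast to the real notions \<open>subspace\<close>, \<open>span\<close>, \<open>dim\<close>.
\<close>

section \<open>Central arrangements\<close>

definition codim :: "(complex ^ 'n) set \<Rightarrow> nat" where
  "codim X = CARD('n) - vec.dim X"

definition central_arrangement :: "(complex ^ 'n) set set \<Rightarrow> bool" where
  "central_arrangement \<A> \<longleftrightarrow> finite \<A> \<and> (\<forall>H\<in>\<A>. vec.subspace H \<and> codim H = 1)"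

text \<open>
  The ambient space \<open>V\<close> is a parameter, because the cone below lives in a proper subspace of its
  type. It is the value of the empty intersection, the least element for reverse inclusion.
\<close>

definition intersections :: "'a set \<Rightarrow> 'a set set \<Rightarrow> 'a set set" where
  "intersections V \<A> = {V \<inter> \<Inter>\<B> | \<B>. \<B> \<subseteq> \<A>}"

definition join_el :: "(complex ^ 'n) set \<Rightarrow> (complex ^ 'n) set \<Rightarrow> (complex ^ 'n) set" where
  "join_el X Y = X \<inter> Y"

definition meet_el ::
  "(complex ^ 'n) set set \<Rightarrow> (complex ^ 'n) set \<Rightarrow> (complex ^ 'n) set \<Rightarrow> (complex ^ 'n) set" where
  "meet_el \<A> X Y = \<Inter>{H \<in> \<A>. {x + y | x y. x \<in> X \<and> y \<in> Y} \<subseteq> H}"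

definition modular_element :: "(complex ^ 'n) set set \<Rightarrow> (complex ^ 'n) set \<Rightarrow> bool" where
  "modular_element \<A> X \<longleftrightarrow> X \<in> intersections UNIV \<A> \<and>
     (\<forall>Y \<in> intersections UNIV \<A>.
        codim (join_el X Y) + codim (meet_el \<A> X Y) = codim X + codim Y)"

definition localization :: "(complex ^ 'n) set set \<Rightarrow> (complex ^ 'n) set \<Rightarrow> (complex ^ 'n) set set" where
  "localization \<A> X = {H \<in> \<A>. X \<subseteq> H}"

text \<open>The quotient by \<open>X\<close> is the set of cosets of \<open>X\<close>, that is, \<open>range (quot_proj X)\<close>.\<close>

definition quot_proj :: "(complex ^ 'n) set \<Rightarrow> complex ^ 'n \<Rightarrow> (complex ^ 'n) set" where
  "quot_proj X v = (\<lambda>x. v + x) ` X"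

definition quot_localization ::
  "(complex ^ 'n) set set \<Rightarrow> (complex ^ 'n) set \<Rightarrow> (complex ^ 'n) set set set" where
  "quot_localization \<A> X = (\<lambda>H. quot_proj X ` H) ` localization \<A> X"

section \<open>Affine arrangements and cones\<close>

definition affine_hyperplane_of :: "(complex ^ 'n) set \<Rightarrow> (complex ^ 'n) set \<Rightarrow> bool" where
  "affine_hyperplane_of S K \<longleftrightarrow>
     (\<exists>w U W. vec.subspace U \<and> vec.subspace W \<and> U \<subseteq> W \<and> vec.dim W = vec.dim U + 1 \<and>
        S = (\<lambda>x. w + x) ` W \<and> K = (\<lambda>x. w + x) ` U)"

definition restriction :: "(complex ^ 'n) set set \<Rightarrow> (complex ^ 'n) set \<Rightarrow> (complex ^ 'n) set set" where
  "restriction \<A> S = {H \<inter> S | H. H \<in> \<A> \<and> affine_hyperplane_of S (H \<inter> S)}"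

text \<open>
  The product of \<open>\<complex>\<close> with \<open>complex ^ 'n\<close> is \<open>complex ^ 'n option\<close>, with \<open>None\<close> indexing the
  additional coordinate; \<open>at_height t K\<close> is \<open>{t} \<times> K\<close>.
\<close>

definition at_height :: "complex \<Rightarrow> (complex ^ 'n) set \<Rightarrow> (complex ^ 'n option) set" where
  "at_height t K = (\<lambda>x. \<chi> i. case i of None \<Rightarrow> t | Some j \<Rightarrow> x $ j) ` K"

definition direction :: "(complex ^ 'n) set \<Rightarrow> (complex ^ 'n) set" where
  "direction S = {x - y | x y. x \<in> S \<and> y \<in> S}"

text \<open>
  The cone over an affine arrangement \<open>\<B>\<close> in an affine space \<open>S\<close> of dimension \<open>m\<close>, without a choice
  of coordinates on \<open>S\<close>. It is an arrangement in the \<open>(m + 1)\<close>-dimensional space \<open>cone_space S\<close>.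
  For \<open>S = UNIV\<close> this is the whole space, and the adjoined hyperplane is \<open>at_height 0 UNIV\<close>.
\<close>

definition cone_space :: "(complex ^ 'n) set \<Rightarrow> (complex ^ 'n option) set" where
  "cone_space S = vec.span (at_height 1 S)"

definition arr_cone :: "(complex ^ 'n) set \<Rightarrow> (complex ^ 'n) set set \<Rightarrow> (complex ^ 'n option) set set" where
  "arr_cone S \<B> = insert (at_height 0 (direction S)) ((\<lambda>K. vec.span (at_height 1 K)) ` \<B>)"

section \<open>Matroids\<close>

record 'a matroid =
  ground :: "'a set"
  indeps :: "'a set set"

definition mat_rank :: "'a matroid \<Rightarrow> 'a set \<Rightarrow> nat" where
  "mat_rank M S = Max (card ` {I \<in> indeps M. I \<subseteq> S})"

definition mat_closure :: "'a matroid \<Rightarrow> 'a set \<Rightarrow> 'a set" where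
  "mat_closure M S = {e \<in> ground M. mat_rank M (insert e S) = mat_rank M S}"

definition flats :: "'a matroid \<Rightarrow> 'a set set" where
  "flats M = {F. F \<subseteq> ground M \<and> mat_closure M F = F}"

definition arr_matroid :: "(complex ^ 'n) set set \<Rightarrow> (complex ^ 'n) set matroid" where
  "arr_matroid \<A> = \<lparr>ground = \<A>, indeps = {\<B>. \<B> \<subseteq> \<A> \<and> \<not> codim (\<Inter>\<B>) < card \<B>}\<rparr>"

text \<open>
  The principal extension: \<open>p\<close> is placed generically on the flat \<open>F\<close>, so it lies in the span of an
  independent set \<open>I\<close> of old elements only if \<open>I\<close> spans all of \<open>F\<close>.
\<close>

definition principal_extension :: "'a matroid \<Rightarrow> 'a set \<Rightarrow> 'a \<Rightarrow> 'a matroid" where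
  "principal_extension M F p =
     \<lparr>ground = insert p (ground M),
      indeps = indeps M \<union> {insert p I | I. I \<in> indeps M \<and> \<not> F \<subseteq> mat_closure M I}\<rparr>"

definition embed_matroid :: "'a matroid \<Rightarrow> ('a + nat) matroid" where
  "embed_matroid M = \<lparr>ground = Inl ` ground M, indeps = (\<lambda>I. Inl ` I) ` indeps M\<rparr>"

text \<open>
  The points \<open>Inr 0, \<dots>, Inr (k - 1)\<close> are added one after the other, each of them generically on the
  flat spanned by \<open>F\<close> in the matroid extended so far.
\<close>

primrec add_generic_points :: "'a matroid \<Rightarrow> 'a set \<Rightarrow> nat \<Rightarrow> ('a + nat) matroid" where
  "add_generic_points M F 0 = embed_matroid M"
| "add_generic_points M F (Suc k) =
     principal_extension (add_generic_points M F k)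
       (mat_closure (add_generic_points M F k) (Inl ` F)) (Inr k)"

definition contraction :: "'a matroid \<Rightarrow> 'a set \<Rightarrow> 'a matroid" where
  "contraction M T =
     \<lparr>ground = ground M - T,
      indeps = {I. finite I \<and> I \<subseteq> ground M - T \<and> mat_rank M (I \<union> T) = mat_rank M T + card I}\<rparr>"

definition parallel_class :: "'a matroid \<Rightarrow> 'a \<Rightarrow> 'a set" where
  "parallel_class M e = mat_closure M {e} - mat_closure M {}"

text \<open>Loops are discarded, and the parallel classes become the elements.\<close>

definition simplification :: "'a matroid \<Rightarrow> 'a set matroid" where
  "simplification M =
     \<lparr>ground = parallel_class M ` (ground M - mat_closure M {}),
      indeps = (\<lambda>I. parallel_class M ` I) ` indeps M\<rparr>"

text \<open>
  This is meaningful for flats \<open>F\<close> of positive rank only: for rank \<open>0\<close> the number of added points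
  would be negative.
\<close>

definition complete_principal_truncation :: "'a matroid \<Rightarrow> 'a set \<Rightarrow> ('a + nat) set matroid" where
  "complete_principal_truncation M F =
     (let k = mat_rank M F - 1; N = add_generic_points M F k
      in simplification (contraction N (mat_closure N (Inr ` {..<k}))))"

section \<open>Isomorphism of lattices\<close>

definition order_isomorphic ::
  "'a set \<Rightarrow> ('a \<Rightarrow> 'a \<Rightarrow> bool) \<Rightarrow> 'b set \<Rightarrow> ('b \<Rightarrow> 'b \<Rightarrow> bool) \<Rightarrow> bool" where
  "order_isomorphic A le B le' \<longleftrightarrow>
     (\<exists>f. bij_betw f A B \<and> (\<forall>x\<in>A. \<forall>y\<in>A. le x y \<longleftrightarrow> le' (f x) (f y)))"

end

theory Submission
  imports Defs
begin

text \<open>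
  Put \<open>W = \<complex>v + X\<close>. Since \<open>v\<close> lies in no hyperplane containing \<open>X\<close>, the projection of the cone
  space onto its last coordinates is an isomorphism onto \<open>W\<close> that carries the cone over
  \<open>\<A>\<^sub>v\<close> to the arrangement of all \<open>H \<inter> W\<close>: the hyperplanes containing \<open>X\<close> all meet \<open>W\<close> in \<open>X\<close>,
  which is the hyperplane at infinity. So the intersections correspond to the sets of hyperplanes
  closed for the rank function \<open>codim\<^sub>W (W \<inter> \<Inter>\<B>)\<close>. The truncation has, before simplification, the rank
  function \<open>min (r \<B>) (r (\<B> \<union> \<A>\<^sub>X) - (r \<A>\<^sub>X - 1))\<close>. The two agree because \<open>X\<close> is modular: with
  \<open>Y = \<Inter>\<B>\<close>, the sum \<open>X + Y\<close> is an intersection of members of \<open>\<A>\<close>, so \<open>v \<in> X + Y\<close> forces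
  \<open>X + Y\<close> to be the whole space.
\<close>

section \<open>Matroids given by a rank function\<close>

text \<open>\<open>mat_rank\<close> is a maximum over independent sets and awkward to compute. The
  arrangement matroid, its generic extensions and the contraction are therefore each paired with an
  explicit rank formula \<open>r\<close>, from which closures and flats are read off. The
  simplification is handled through the \<open>r\<close> of the matroid it comes from.\<close>

locale ranked_matroid =
  fixes M :: "'a matroid" and r :: "'a set \<Rightarrow> nat"
  assumes finite_ground: "finite (ground M)"
    and rank_le_card: "S \<subseteq> ground M \<Longrightarrow> r S \<le> card S"
    and rank_mono: "S \<subseteq> T \<Longrightarrow> T \<subseteq> ground M \<Longrightarrow> r S \<le> r T"
    and rank_submodular:
      "S \<subseteq> ground M \<Longrightarrow> T \<subseteq> ground M \<Longrightarrow> r (S \<union> T) + r (S \<inter> T) \<le> r S + r T"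
    and indeps_eq: "indeps M = {I. I \<subseteq> ground M \<and> r I = card I}"
begin

lemma finite_subset_ground: "S \<subseteq> ground M \<Longrightarrow> finite S"
  using finite_ground finite_subset by blast

lemma rank_empty [simp]: "r {} = 0"
  using rank_le_card[of "{}"] by simp

text \<open>Submodularity for \<open>insert e S\<close> and \<open>T\<close>: their union is
  \<open>insert e T\<close>, and their intersection still contains \<open>S\<close>.\<close>

lemma rank_insert_absorb_mono:
  assumes "r (insert e S) = r S" "S \<subseteq> T" "T \<subseteq> ground M" "e \<in> ground M"
  shows "r (insert e T) = r T"
proof (rule antisym)
  have "r (insert e S \<union> T) + r (insert e S \<inter> T) \<le> r (insert e S) + r T"
    using assms by (intro rank_submodular) auto
  moreover have "insert e S \<union> T = insert e T" "r S \<le> r (insert e S \<inter> T)"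
    using assms by (auto intro!: rank_mono)
  ultimately show "r (insert e T) \<le> r T"
    using assms(1) by simp
qed (use assms in \<open>auto intro!: rank_mono\<close>)

lemma rank_union_absorb:
  assumes "S \<subseteq> ground M" "T \<subseteq> ground M" "\<And>e. e \<in> T \<Longrightarrow> r (insert e S) = r S"
  shows "r (S \<union> T) = r S"
proof -
  have "finite T"
    using assms finite_subset_ground by blast
  then show ?thesis
    using assms(2,3)
  proof (induction T)
    case (insert e T)
    have "r (insert e (S \<union> T)) = r (S \<union> T)"
      using rank_insert_absorb_mono[of e S "S \<union> T"] insert.prems assms(1) by auto
    then show ?case
      using insert by simp
  qed simp
qed

lemma rank_insert_le:
  assumes "S \<subseteq> ground M" "e \<in> ground M"
  shows "r (insert e S) \<le> Suc (r S)"
proof -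
  have "r ({e} \<union> S) + r ({e} \<inter> S) \<le> r {e} + r S"
    using assms by (intro rank_submodular) auto
  then show ?thesis
    using rank_le_card[of "{e}"] assms by simp
qed

lemma card_le_rank:
  assumes "I \<in> indeps M" "I \<subseteq> S" "S \<subseteq> ground M"
  shows "card I \<le> r S"
  using assms rank_mono[of I S] indeps_eq by auto

text \<open>A largest independent \<open>I\<close> inside \<open>S\<close> absorbs every
  \<open>e\<close> of \<open>S\<close>: one element raises the rank by at most one, and a rise would
  make \<open>insert e I\<close> independent and larger. Absorbing all of \<open>S\<close> gives
  \<open>r I = r S\<close>.\<close>

lemma exists_basis:
  assumes "S \<subseteq> ground M"
  shows "\<exists>I \<in> indeps M. I \<subseteq> S \<and> card I = r S"
proof -
  let ?Q = "\<lambda>I. I \<in> indeps M \<and> I \<subseteq> S"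
  have "?Q {}"
    by (simp add: indeps_eq)
  moreover have "\<forall>I. ?Q I \<longrightarrow> card I < Suc (r S)"
    using card_le_rank[OF _ _ assms] by (auto simp: less_Suc_eq_le)
  ultimately obtain I where I: "?Q I" and max: "\<And>J. ?Q J \<Longrightarrow> card J \<le> card I"
    using ex_has_greatest_nat[of ?Q "{}" card "Suc (r S)"] by metis
  have rI: "r I = card I" and Ig: "I \<subseteq> ground M" "finite I"
    using I assms finite_subset_ground by (auto simp: indeps_eq)
  have "r (insert e I) = r I" if "e \<in> S" for e
  proof (cases "e \<in> I")
    case False
    have eg: "insert e I \<subseteq> ground M"
      using that assms Ig by auto
    have "\<not> ?Q (insert e I)"
      using max[of "insert e I"] False Ig by auto
    then have "r (insert e I) \<noteq> Suc (r I)"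
      using that I eg False Ig rI by (auto simp: indeps_eq)
    moreover have "r I \<le> r (insert e I)"
      using eg by (intro rank_mono) auto
    ultimately show ?thesis
      using rank_insert_le[of I e] eg by auto
  qed (simp add: insert_absorb)
  then have "r (I \<union> S) = r I"
    using rank_union_absorb Ig assms by blast
  moreover have "I \<union> S = S"
    using I by auto
  ultimately show ?thesis
    using I rI by metis
qed

lemma mat_rank_eq:
  assumes "S \<subseteq> ground M"
  shows "mat_rank M S = r S"
  unfolding mat_rank_def
proof (rule Max_eqI)
  show "finite (card ` {I \<in> indeps M. I \<subseteq> S})"
    using finite_subset_ground[OF assms] by simp
  show "r S \<in> card ` {I \<in> indeps M. I \<subseteq> S}"
    using exists_basis[OF assms] by force
qed (use card_le_rank assms in auto)

lemma mat_closure_eq: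
  assumes "S \<subseteq> ground M"
  shows "mat_closure M S = {e \<in> ground M. r (insert e S) = r S}"
  using assms mat_rank_eq unfolding mat_closure_def by auto

lemma subset_mat_closure_iff:
  assumes "S \<subseteq> ground M" "T \<subseteq> ground M"
  shows "T \<subseteq> mat_closure M S \<longleftrightarrow> r (S \<union> T) = r S"
proof
  assume "T \<subseteq> mat_closure M S"
  then show "r (S \<union> T) = r S"
    by (intro rank_union_absorb assms) (use assms in \<open>auto simp: mat_closure_eq\<close>)
next
  assume eq: "r (S \<union> T) = r S"
  have "r (insert e S) = r S" if "e \<in> T" for e
  proof (rule antisym)
    show "r (insert e S) \<le> r S"
      using that assms eq rank_mono[of "insert e S" "S \<union> T"] by auto
  qed (use that assms in \<open>auto intro!: rank_mono\<close>)
  then show "T \<subseteq> mat_closure M S"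
    using assms by (auto simp: mat_closure_eq)
qed

text \<open>The chain \<open>card I = r I \<le> r J + r (I - J) \<le> card J + card (I - J) = card
  I\<close> forces equality throughout.\<close>

lemma indep_subset:
  assumes "I \<in> indeps M" "J \<subseteq> I"
  shows "J \<in> indeps M"
proof -
  have I: "I \<subseteq> ground M" "r I = card I" "finite I"
    using assms finite_subset_ground by (auto simp: indeps_eq)
  have "r (J \<union> (I - J)) + r (J \<inter> (I - J)) \<le> r J + r (I - J)"
    using assms I by (intro rank_submodular) auto
  moreover have "J \<union> (I - J) = I" "J \<inter> (I - J) = {}"
    using assms by auto
  moreover have "r (I - J) \<le> card (I - J)" "r J \<le> card J"
    using I assms by (auto intro!: rank_le_card)
  moreover have "card I = card J + card (I - J)"
    using assms I by (metis card_Diff_subset card_mono finite_subset le_add_diff_inverse)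
  ultimately show ?thesis
    using I assms by (auto simp: indeps_eq)
qed

end

section \<open>Contraction and simplification\<close>

context ranked_matroid
begin

lemma ranked_matroid_contraction:
  assumes "T \<subseteq> ground M"
  shows "ranked_matroid (contraction M T) (\<lambda>S. r (S \<union> T) - r T)"
proof
  show "finite (ground (contraction M T))"
    using finite_ground by (simp add: contraction_def)
next
  fix S assume S: "S \<subseteq> ground (contraction M T)"
  then have "r (S \<union> T) + r (S \<inter> T) \<le> r S + r T" "r S \<le> card S"
    using assms by (auto simp: contraction_def intro!: rank_submodular rank_le_card)
  then show "r (S \<union> T) - r T \<le> card S"
    by simp
next
  fix S U assume "S \<subseteq> U" "U \<subseteq> ground (contraction M T)"
  then show "r (S \<union> T) - r T \<le> r (U \<union> T) - r T"
    using assms by (auto simp: contraction_def intro!: diff_le_mono rank_mono)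
next
  fix S U assume "S \<subseteq> ground (contraction M T)" "U \<subseteq> ground (contraction M T)"
  then have SU: "S \<subseteq> ground M" "U \<subseteq> ground M"
    by (auto simp: contraction_def)
  have "r ((S \<union> T) \<union> (U \<union> T)) + r ((S \<union> T) \<inter> (U \<union> T)) \<le> r (S \<union> T) + r (U \<union> T)"
    using SU assms by (intro rank_submodular) auto
  moreover have "(S \<union> T) \<union> (U \<union> T) = (S \<union> U) \<union> T" "(S \<union> T) \<inter> (U \<union> T) = (S \<inter> U) \<union> T"
    by auto
  \<comment> \<open>\<open>r T\<close> lies below each of the four terms, so the truncated
    subtractions are genuine and cancel.\<close>
  moreover have "r T \<le> r ((S \<inter> U) \<union> T)" "r T \<le> r (S \<union> T)" "r T \<le> r (U \<union> T)"
      "r T \<le> r ((S \<union> U) \<union> T)"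
    using SU assms by (auto intro!: rank_mono)
  ultimately show "r (S \<union> U \<union> T) - r T + (r (S \<inter> U \<union> T) - r T)
      \<le> r (S \<union> T) - r T + (r (U \<union> T) - r T)"
    by simp
next
  have "mat_rank M (I \<union> T) = mat_rank M T + card I \<longleftrightarrow> r (I \<union> T) - r T = card I"
    if "I \<subseteq> ground M - T" for I
  proof -
    have "r T \<le> r (I \<union> T)" "I \<union> T \<subseteq> ground M"
      using that assms by (auto intro!: rank_mono)
    then show ?thesis
      using assms by (auto simp: mat_rank_eq)
  qed
  then show "indeps (contraction M T)
      = {I. I \<subseteq> ground (contraction M T) \<and> r (I \<union> T) - r T = card I}"
    using finite_subset_ground by (auto simp: contraction_def)
qed

section \<open>Loops and parallel classes\<close>

lemma nonloop_iff:
  "e \<in> ground M - mat_closure M {} \<longleftrightarrow> e \<in> ground M \<and> r {e} = 1"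
  using rank_le_card[of "{e}"] by (auto simp: mat_closure_eq)

lemma mem_parallel_class_iff:
  assumes "e \<in> ground M"
  shows "f \<in> parallel_class M e \<longleftrightarrow> f \<in> ground M - mat_closure M {} \<and> r {e, f} = r {e}"
  using assms by (auto simp: parallel_class_def mat_closure_eq insert_commute)

lemma parallel_class_eq_iff:
  assumes "e \<in> ground M - mat_closure M {}" "f \<in> ground M - mat_closure M {}"
  shows "parallel_class M e = parallel_class M f \<longleftrightarrow> r {e, f} = 1"
proof
  assume "parallel_class M e = parallel_class M f"
  moreover have "f \<in> parallel_class M f"
    using assms by (simp add: mem_parallel_class_iff)
  ultimately have "f \<in> parallel_class M e"
    by simp
  then have "r {e, f} = r {e}"
    using assms by (simp add: mem_parallel_class_iff)
  then show "r {e, f} = 1"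
    using assms unfolding nonloop_iff by simp
next
  \<comment> \<open>By symmetry one inclusion suffices. Anything parallel to \<open>e\<close> is
    absorbed by \<open>{e}\<close>, hence by the rank 1 set \<open>{e, f}\<close>, and so is
    parallel to \<open>f\<close>.\<close>
  have *: "parallel_class M e \<subseteq> parallel_class M f"
    if "r {e, f} = 1" "e \<in> ground M" "r {e} = 1" "f \<in> ground M" "r {f} = 1" for e f
  proof
    fix g assume "g \<in> parallel_class M e"
    then have "g \<in> ground M - mat_closure M {}" "r {e, g} = 1"
      using that by (simp_all add: mem_parallel_class_iff)
    then have g: "g \<in> ground M" "r {g} = 1" "r {e, g} = 1"
      unfolding nonloop_iff by simp_all
    have "r (insert g {e, f}) = r {e, f}"
      using rank_insert_absorb_mono[of g "{e}" "{e, f}"] that g by (simp add: insert_commute)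
    then have "r {f, g} \<le> 1"
      using rank_mono[of "{f, g}" "insert g {e, f}"] that g by auto
    moreover have "r {f} \<le> r {f, g}"
      using that g by (intro rank_mono) auto
    ultimately show "g \<in> parallel_class M f"
      using that g by (simp add: mem_parallel_class_iff nonloop_iff del: Diff_iff)
  qed
  assume "r {e, f} = 1"
  then show "parallel_class M e = parallel_class M f"
    using *[of e f] *[of f e] assms unfolding nonloop_iff by (simp add: insert_commute)
qed

lemma inj_on_parallel_class:
  assumes "I \<in> indeps M"
  shows "inj_on (parallel_class M) I"
proof
  fix e f assume ef: "e \<in> I" "f \<in> I" "parallel_class M e = parallel_class M f"
  have ind: "{e} \<in> indeps M" "{f} \<in> indeps M" "{e, f} \<in> indeps M"
    using ef by (auto intro!: indep_subset[OF assms])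
  then have "r {e, f} = 1"
    using ef parallel_class_eq_iff[of e f] unfolding nonloop_iff by (auto simp: indeps_eq)
  then show "e = f"
    using ind by (cases "e = f") (auto simp: indeps_eq)
qed

text \<open>The classes partition the nonloops, so a class that meets \<open>\<Union>C\<close> is
  already a member of \<open>C\<close>. A set of classes can thus be replaced by its union.\<close>

lemma parallel_class_in_iff:
  assumes "C \<subseteq> ground (simplification M)" "e \<in> ground M - mat_closure M {}"
  shows "parallel_class M e \<in> C \<longleftrightarrow> e \<in> \<Union>C"
proof
  assume "parallel_class M e \<in> C"
  moreover have "e \<in> parallel_class M e"
    using assms by (simp add: mem_parallel_class_iff)
  ultimately show "e \<in> \<Union>C"
    by blast
next
  assume "e \<in> \<Union>C"
  then obtain f where f: "f \<in> ground M - mat_closure M {}" "parallel_class M f \<in> C"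
      "e \<in> parallel_class M f"
    using assms by (auto simp: simplification_def)
  then have "r {f, e} = 1"
    unfolding nonloop_iff by (simp add: mem_parallel_class_iff)
  then have "parallel_class M f = parallel_class M e"
    using parallel_class_eq_iff assms f by blast
  then show "parallel_class M e \<in> C"
    using f by simp
qed

lemma Union_simplification_subset:
  assumes "C \<subseteq> ground (simplification M)"
  shows "\<Union>C \<subseteq> ground M - mat_closure M {}"
  using assms by (auto simp: simplification_def parallel_class_def mat_closure_def)

text \<open>Independent sets contain no loops and meet each class at most once. Forming classes
  therefore preserves their size, and it maps those inside \<open>\<Union>C\<close> onto the
  independent sets of the simplification inside \<open>C\<close>.\<close>

lemma mat_rank_simplification:
  assumes C: "C \<subseteq> ground (simplification M)"
  shows "mat_rank (simplification M) C = r (\<Union>C)"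
proof -
  have "parallel_class M ` I \<subseteq> C \<longleftrightarrow> I \<subseteq> \<Union>C" if "I \<in> indeps M" for I
  proof -
    have "{e} \<in> indeps M" if "e \<in> I" for e
      using that \<open>I \<in> indeps M\<close> by (auto intro: indep_subset)
    then have "e \<in> ground M - mat_closure M {}" if "e \<in> I" for e
      unfolding nonloop_iff using that by (auto simp: indeps_eq)
    then show ?thesis
      using parallel_class_in_iff[OF C] by blast
  qed
  then have "{J \<in> indeps (simplification M). J \<subseteq> C}
      = (\<lambda>I. parallel_class M ` I) ` {I \<in> indeps M. I \<subseteq> \<Union>C}"
    by (auto simp: simplification_def)
  moreover have "card (parallel_class M ` I) = card I" if "I \<in> indeps M" for I
    using inj_on_parallel_class[OF that] by (rule card_image)
  ultimately have "card ` {J \<in> indeps (simplification M). J \<subseteq> C}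
      = card ` {I \<in> indeps M. I \<subseteq> \<Union>C}"
    by (force simp: image_image)
  then show ?thesis
    using mat_rank_eq[of "\<Union>C"] Union_simplification_subset[OF C]
    unfolding mat_rank_def by (metis Diff_subset subset_trans)
qed

lemma rank_union_parallel_class:
  assumes "S \<subseteq> ground M" "e \<in> ground M - mat_closure M {}"
  shows "r (parallel_class M e \<union> S) = r (insert e S)"
proof -
  have "r (insert e S \<union> parallel_class M e) = r (insert e S)"
  proof (rule rank_union_absorb)
    fix f assume f: "f \<in> parallel_class M e"
    then have "r (insert f {e}) = r {e}" "f \<in> ground M"
      using assms by (auto simp: mem_parallel_class_iff insert_commute)
    then show "r (insert f (insert e S)) = r (insert e S)"
      using assms rank_insert_absorb_mono[of f "{e}" "insert e S"] by auto
  qed (use assms in \<open>auto simp: parallel_class_def mat_closure_def\<close>)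
  moreover have "insert e S \<union> parallel_class M e = parallel_class M e \<union> S"
    using assms by (auto simp: mem_parallel_class_iff)
  ultimately show ?thesis
    by simp
qed

section \<open>Flats before and after simplification\<close>

lemma mem_flats_iff:
  "F \<in> flats M \<longleftrightarrow> F \<subseteq> ground M \<and> (\<forall>e\<in>ground M. r (insert e F) = r F \<longrightarrow> e \<in> F)"
  unfolding flats_def by (auto simp: mat_closure_eq insert_absorb)

text \<open>Adjoining a class to \<open>C\<close> has the same effect on the rank as adjoining one
  representative to \<open>\<Union>C\<close>, so the flat condition can be tested in
  \<open>M\<close> on nonloops.\<close>

lemma mem_flats_simplification_iff:
  assumes C: "C \<subseteq> ground (simplification M)"
  shows "C \<in> flats (simplification M) \<longleftrightarrow>
    (\<forall>e \<in> ground M - mat_closure M {}. r (insert e (\<Union>C)) = r (\<Union>C) \<longrightarrow> e \<in> \<Union>C)"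
proof -
  have rank: "mat_rank (simplification M) (insert (parallel_class M e) C) = r (insert e (\<Union>C))"
    if "e \<in> ground M - mat_closure M {}" for e
  proof -
    have "insert (parallel_class M e) C \<subseteq> ground (simplification M)"
      using that C by (auto simp: simplification_def)
    then have "mat_rank (simplification M) (insert (parallel_class M e) C)
        = r (parallel_class M e \<union> \<Union>C)"
      by (simp add: mat_rank_simplification)
    then show ?thesis
      using rank_union_parallel_class[of "\<Union>C" e] Union_simplification_subset[OF C] that by auto
  qed
  have "mat_closure (simplification M) C
      = parallel_class M ` {e \<in> ground M - mat_closure M {}. r (insert e (\<Union>C)) = r (\<Union>C)}"
  proof -
    have "mat_closure (simplification M) C = {c \<in> parallel_class M ` (ground M - mat_closure M {}).
        mat_rank (simplification M) (insert c C) = mat_rank (simplification M) C}"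
      by (simp add: mat_closure_def simplification_def)
    also have "\<dots> = parallel_class M ` {e \<in> ground M - mat_closure M {}.
        r (insert e (\<Union>C)) = r (\<Union>C)}"
      using rank mat_rank_simplification[OF C] by force
    finally show ?thesis .
  qed
  moreover have "C \<subseteq> mat_closure (simplification M) C"
    using C by (auto simp: mat_closure_def insert_absorb)
  ultimately have "C \<in> flats (simplification M) \<longleftrightarrow>
      parallel_class M ` {e \<in> ground M - mat_closure M {}. r (insert e (\<Union>C)) = r (\<Union>C)} \<subseteq> C"
    using C unfolding flats_def by auto
  then show ?thesis
    using parallel_class_in_iff[OF C] by blast
qed

lemma rank_union_loops:
  assumes "S \<subseteq> ground M" "T \<subseteq> mat_closure M {}"
  shows "r (S \<union> T) = r S"
proof (rule rank_union_absorb)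
  show "T \<subseteq> ground M"
    using assms by (auto simp: mat_closure_def)
  fix e assume "e \<in> T"
  then have "e \<in> ground M" "r (insert e {}) = r {}"
    using assms by (auto simp: mat_closure_eq)
  then show "r (insert e S) = r S"
    using rank_insert_absorb_mono[of e "{}" S] assms by auto
qed (use assms in auto)

text \<open>A flat contains every loop and, with each nonloop, its whole parallel class. It is
  recovered from its set of classes as their union together with the loops.\<close>

lemma flats_simplification_isomorphic:
  "order_isomorphic (flats M) (\<subseteq>) (flats (simplification M)) (\<subseteq>)"
proof -
  let ?L = "mat_closure M {}"
  define f where "f F = parallel_class M ` (F - ?L)" for F
  have L: "?L \<subseteq> ground M"
    by (auto simp: mat_closure_def)
  have ground_f: "f F \<subseteq> ground (simplification M)" if "F \<subseteq> ground M" for F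
    using that by (auto simp: f_def simplification_def)
  have loops: "?L \<subseteq> F" if "F \<in> flats M" for F
    using that rank_union_loops[of F "{e}" for e] unfolding mem_flats_iff
    by (auto simp: mat_closure_def)
  have Un_f: "\<Union>(f F) = F - ?L" if "F \<in> flats M" for F
  proof -
    have "e \<in> F" if "f \<in> F" "f \<notin> ?L" "e \<in> parallel_class M f" for e f
    proof -
      have f: "f \<in> ground M" "F \<subseteq> ground M"
        using that \<open>F \<in> flats M\<close> by (auto simp: mem_flats_iff)
      then have "e \<in> ground M" "r (insert e {f}) = r {f}"
        using that by (auto simp: mem_parallel_class_iff insert_commute)
      then have "r (insert e F) = r F"
        using that f by (intro rank_insert_absorb_mono[of e "{f}" F]) auto
      then show ?thesis
        using \<open>F \<in> flats M\<close> \<open>e \<in> ground M\<close> by (auto simp: mem_flats_iff)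
    qed
    moreover have "e \<in> parallel_class M e" if "e \<in> F - ?L" for e
      using that \<open>F \<in> flats M\<close> by (auto simp: mem_parallel_class_iff mem_flats_iff)
    ultimately show ?thesis
      unfolding f_def by (auto simp: parallel_class_def)
  qed
  have ord: "F \<subseteq> F' \<longleftrightarrow> f F \<subseteq> f F'" if "F \<in> flats M" "F' \<in> flats M" for F F'
  proof
    assume "f F \<subseteq> f F'"
    then have "\<Union>(f F) \<subseteq> \<Union>(f F')"
      by (rule Union_mono)
    then have "F - ?L \<subseteq> F' - ?L"
      using that by (simp only: Un_f)
    then show "F \<subseteq> F'"
      using loops[OF that(2)] by blast
  qed (auto simp: f_def)
  have "bij_betw f (flats M) (flats (simplification M))"
    unfolding bij_betw_def
  proof (intro conjI subset_antisym subsetI)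
    show "inj_on f (flats M)"
      using ord by (intro inj_onI) (metis order_refl subset_antisym)
  next
    fix C assume "C \<in> f ` flats M"
    then obtain F where F: "F \<in> flats M" "C = f F"
      by blast
    then have Fg: "F \<subseteq> ground M"
      by (auto simp: mem_flats_iff)
    \<comment> \<open>Loops change no rank, so the flat condition for \<open>F\<close> carries over
      to \<open>F - ?L\<close>, the union of its classes.\<close>
    have "r (insert e (F - ?L)) = r (insert e F)" "r (F - ?L) = r F" if "e \<in> ground M" for e
    proof -
      have "r ((F - ?L) \<union> (F \<inter> ?L)) = r (F - ?L)"
          "r (insert e (F - ?L) \<union> (F \<inter> ?L)) = r (insert e (F - ?L))"
        using that Fg by (intro rank_union_loops; auto)+
      moreover have "(F - ?L) \<union> (F \<inter> ?L) = F" "insert e (F - ?L) \<union> (F \<inter> ?L) = insert e F"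
        by auto
      ultimately show "r (insert e (F - ?L)) = r (insert e F)" "r (F - ?L) = r F"
        by auto
    qed
    then show "C \<in> flats (simplification M)"
      using F mem_flats_simplification_iff[OF ground_f[OF Fg]] Un_f
      by (auto simp: mem_flats_iff)
  next
    fix C assume C: "C \<in> flats (simplification M)"
    then have Cg: "C \<subseteq> ground (simplification M)"
      by (simp add: flats_def)
    note U = Union_simplification_subset[OF Cg]
    define F where "F = \<Union>C \<union> ?L"
    have "F \<in> flats M"
      unfolding mem_flats_iff
    proof (intro conjI ballI impI)
      show "F \<subseteq> ground M"
        using U L by (auto simp: F_def)
      fix e assume e: "e \<in> ground M" "r (insert e F) = r F"
      have "r (insert e (\<Union>C) \<union> ?L) = r (insert e (\<Union>C))" "r (\<Union>C \<union> ?L) = r (\<Union>C)"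
        using e U by (intro rank_union_loops; auto)+
      then have "r (insert e (\<Union>C)) = r (\<Union>C)"
        using e by (simp add: F_def)
      then show "e \<in> F"
        using e C mem_flats_simplification_iff[OF Cg] by (auto simp: F_def)
    qed
    moreover have "f F = C"
    proof -
      have "F - ?L = \<Union>C"
        using U by (auto simp: F_def)
      then have "f F = {parallel_class M e | e. e \<in> ground M - ?L \<and> parallel_class M e \<in> C}"
        using parallel_class_in_iff[OF Cg] U unfolding f_def by blast
      then show ?thesis
        using Cg by (auto simp: simplification_def)
    qed
    ultimately show "C \<in> f ` flats M"
      by blast
  qed
  then show ?thesis
    using ord unfolding order_isomorphic_def by blast
qed

end

section \<open>Adding generic points\<close>

lemma card_vimage_Inl_Inr:
  assumes "finite (Inl -` S)" "finite (Inr -` S)"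
  shows "card (Inl -` S) + card (Inr -` S) = card S"
proof -
  have "Inl -` S <+> Inr -` S = S"
    by (auto simp: Plus_def image_iff) (metis sumE)
  then show ?thesis
    using card_Plus[OF assms] by simp
qed

context ranked_matroid
begin

text \<open>\<open>add_generic_points\<close> places each point on the closure of \<open>F\<close>.
  This reduces the spanning test for that closure to one for \<open>F\<close> itself.\<close>

lemma mat_closure_subset_iff:
  assumes "S \<subseteq> ground M" "T \<subseteq> ground M"
  shows "mat_closure M S \<subseteq> mat_closure M T \<longleftrightarrow> S \<subseteq> mat_closure M T"
proof
  assume "mat_closure M S \<subseteq> mat_closure M T"
  moreover have "S \<subseteq> mat_closure M S"
    using assms by (auto simp: mat_closure_eq insert_absorb)
  ultimately show "S \<subseteq> mat_closure M T"
    by blast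
next
  assume "S \<subseteq> mat_closure M T"
  then have TS: "r (T \<union> S) = r T"
    using assms by (simp add: subset_mat_closure_iff)
  show "mat_closure M S \<subseteq> mat_closure M T"
  proof
    fix e assume "e \<in> mat_closure M S"
    then have e: "e \<in> ground M" "r (insert e S) = r S"
      using assms by (auto simp: mat_closure_eq)
    have "r (insert e T) \<le> r (insert e (T \<union> S))"
      using assms e by (intro rank_mono) auto
    also have "\<dots> = r (T \<union> S)"
      by (rule rank_insert_absorb_mono[of e S]) (use assms e in \<open>auto\<close>)
    finally have "r (insert e T) \<le> r T"
      using TS by simp
    moreover have "r T \<le> r (insert e T)"
      using assms e by (intro rank_mono) auto
    ultimately show "e \<in> mat_closure M T"
      using assms e by (simp add: mat_closure_eq)
  qed
qed

text \<open>
  The points of \<open>Inr -` S\<close> raise the rank one by one until the span of \<open>S\<close> contains \<open>F\<close>.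
\<close>

definition generic_rank :: "'a set \<Rightarrow> ('a + nat) set \<Rightarrow> nat" where
  "generic_rank F S = min (r (Inl -` S) + card (Inr -` S)) (r (Inl -` S \<union> F))"

lemma ground_add_generic_points:
  "ground (add_generic_points M F k) = Inl ` ground M \<union> Inr ` {..<k}"
  by (induction k) (auto simp: embed_matroid_def principal_extension_def)

text \<open>The description of \<open>indeps N\<close> is a hypothesis, so that the result can serve
  inside the induction that establishes it. Submodularity of the minimum splits by which term
  attains it on \<open>S\<close> and on \<open>T\<close>.\<close>

lemma ranked_matroid_generic:
  fixes k :: nat
  assumes F: "F \<subseteq> ground M"
    and ground: "ground N = Inl ` ground M \<union> Inr ` {..<k}"
    and indeps: "indeps N = {I. I \<subseteq> ground N \<and> generic_rank F I = card I}"
  shows "ranked_matroid N (generic_rank F)"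
proof
  show "finite (ground N)"
    using finite_ground by (simp add: ground)
next
  have l: "Inl -` S \<subseteq> ground M" if "S \<subseteq> ground N" for S
    using that by (auto simp: ground)
  have r: "finite (Inr -` S)" if "S \<subseteq> ground N" for S
    using that by (auto simp: ground intro: finite_subset[of _ "{..<k}"])
  {
    fix S assume S: "S \<subseteq> ground N"
    have fin: "finite (Inl -` S)"
      using l[OF S] finite_subset_ground by blast
    show "generic_rank F S \<le> card S"
      using rank_le_card[OF l[OF S]] card_vimage_Inl_Inr[OF fin r[OF S]]
      by (simp add: generic_rank_def)
  next
    fix S T assume ST: "S \<subseteq> T" "T \<subseteq> ground N"
    have "r (Inl -` S) \<le> r (Inl -` T)" "card (Inr -` S) \<le> card (Inr -` T)"
      "r (Inl -` S \<union> F) \<le> r (Inl -` T \<union> F)"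
      using ST l[OF ST(2)] F r[OF ST(2)] by (auto intro!: rank_mono card_mono)
    then show "generic_rank F S \<le> generic_rank F T"
      by (auto simp: generic_rank_def min_def)
  next
    \<comment> \<open>The case of the first term for \<open>S\<close> and the second for
      \<open>T\<close>: the union is bounded by the term with \<open>F\<close>, the intersection by
      the term that counts points.\<close>
    have mixed: "generic_rank F (S \<union> T) + generic_rank F (S \<inter> T)
        \<le> r (Inl -` S) + card (Inr -` S) + r (Inl -` T \<union> F)"
      if "S \<subseteq> ground N" "T \<subseteq> ground N" for S T
    proof -
      have "r (Inl -` S \<union> (Inl -` T \<union> F)) + r (Inl -` S \<inter> (Inl -` T \<union> F))
          \<le> r (Inl -` S) + r (Inl -` T \<union> F)"
        using that l F by (intro rank_submodular) auto
      moreover have "r (Inl -` (S \<inter> T)) \<le> r (Inl -` S \<inter> (Inl -` T \<union> F))"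
        using l[OF that(1)] l[OF that(2)] F by (intro rank_mono) auto
      moreover have "card (Inr -` (S \<inter> T)) \<le> card (Inr -` S)"
        using r[OF that(1)] by (intro card_mono) auto
      ultimately show ?thesis
        by (auto simp: generic_rank_def Un_assoc)
    qed
    fix S T assume ST: "S \<subseteq> ground N" "T \<subseteq> ground N"
    have "r (Inl -` S \<union> Inl -` T) + r (Inl -` S \<inter> Inl -` T) \<le> r (Inl -` S) + r (Inl -` T)"
      using ST l by (intro rank_submodular) auto
    moreover have "card (Inr -` S \<union> Inr -` T) + card (Inr -` S \<inter> Inr -` T)
        = card (Inr -` S) + card (Inr -` T)"
      using card_Un_Int[OF r r] ST by metis
    ultimately have small: "generic_rank F (S \<union> T) + generic_rank F (S \<inter> T)
        \<le> (r (Inl -` S) + card (Inr -` S)) + (r (Inl -` T) + card (Inr -` T))"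
      by (simp add: generic_rank_def)
    have "r ((Inl -` S \<union> F) \<union> (Inl -` T \<union> F)) + r ((Inl -` S \<union> F) \<inter> (Inl -` T \<union> F))
        \<le> r (Inl -` S \<union> F) + r (Inl -` T \<union> F)"
      using ST l F by (intro rank_submodular) auto
    moreover have "(Inl -` S \<union> F) \<union> (Inl -` T \<union> F) = Inl -` (S \<union> T) \<union> F"
        "(Inl -` S \<union> F) \<inter> (Inl -` T \<union> F) = Inl -` (S \<inter> T) \<union> F"
      by auto
    ultimately have large: "generic_rank F (S \<union> T) + generic_rank F (S \<inter> T)
        \<le> r (Inl -` S \<union> F) + r (Inl -` T \<union> F)"
      by (simp add: generic_rank_def)
    show "generic_rank F (S \<union> T) + generic_rank F (S \<inter> T) \<le> generic_rank F S + generic_rank F T"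
      using small large mixed[OF ST] mixed[OF ST(2,1)]
      unfolding generic_rank_def[of F S] generic_rank_def[of F T]
      by (simp add: min_def Un_commute Int_commute)
  }
  show "indeps N = {I. I \<subseteq> ground N \<and> generic_rank F I = card I}"
    by (rule indeps)
qed

lemma indeps_add_generic_points:
  assumes F: "F \<subseteq> ground M"
  shows "indeps (add_generic_points M F k)
    = {I. I \<subseteq> ground (add_generic_points M F k) \<and> generic_rank F I = card I}"
proof (induction k)
  case 0
  have "generic_rank F (Inl ` B) = r B" if "B \<subseteq> ground M" for B
  proof -
    have "r B \<le> r (B \<union> F)"
      using that F by (intro rank_mono) auto
    moreover have "(Inl :: _ \<Rightarrow> 'a + nat) -` Inl ` B = B" "(Inr :: nat \<Rightarrow> _) -` Inl ` B = {}"
      by auto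
    ultimately show ?thesis
      by (simp only: generic_rank_def card.empty)
  qed
  then show ?case
    by (auto simp: embed_matroid_def indeps_eq card_image subset_image_iff)
next
  case (Suc k)
  let ?N = "add_generic_points M F k" and ?p = "Inr k"
  let ?F = "mat_closure ?N (Inl ` F)"
  interpret N: ranked_matroid ?N "generic_rank F"
    using ranked_matroid_generic F ground_add_generic_points Suc.IH by blast
  have p: "?p \<notin> ground ?N"
    by (auto simp: ground_add_generic_points)
  have FN: "Inl ` F \<subseteq> ground ?N"
    using F by (auto simp: ground_add_generic_points)
  \<comment> \<open>Adjoining \<open>?p\<close> raises the first term of \<open>generic_rank\<close>
    by one and leaves the second alone. So \<open>insert ?p J\<close> has full rank exactly if
    \<open>J\<close> is independent and the second term exceeds \<open>card J\<close>, which means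
    that \<open>J\<close> does not span \<open>F\<close>.\<close>
  have key: "generic_rank F (insert ?p J) = card (insert ?p J) \<longleftrightarrow>
      J \<in> indeps ?N \<and> \<not> ?F \<subseteq> mat_closure ?N J" if J: "J \<subseteq> ground ?N" for J
  proof -
    have fin: "finite (Inr -` J)" "finite J"
      using J N.finite_subset_ground by (auto intro!: finite_vimageI)
    have pJ: "?p \<notin> J"
      using p J by blast
    have l: "Inl -` J \<subseteq> ground M"
      using J by (auto simp: ground_add_generic_points)
    have "Inl -` insert ?p J = Inl -` J" "Inr -` insert ?p J = insert k (Inr -` J)"
      by auto
    then have ins: "generic_rank F (insert ?p J)
        = min (Suc (r (Inl -` J) + card (Inr -` J))) (r (Inl -` J \<union> F))"
      using fin pJ by (simp add: generic_rank_def)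
    have "Inl -` (J \<union> Inl ` F) = Inl -` J \<union> F" "Inr -` (J \<union> Inl ` F) = Inr -` J"
      by auto
    then have JF: "generic_rank F (J \<union> Inl ` F) = r (Inl -` J \<union> F)"
      by (simp add: generic_rank_def Un_assoc)
    have "?F \<subseteq> mat_closure ?N J \<longleftrightarrow> r (Inl -` J \<union> F) = generic_rank F J"
      using N.mat_closure_subset_iff[OF FN J] N.subset_mat_closure_iff[OF J FN] JF by simp
    moreover have "r (Inl -` J) + card (Inr -` J) \<le> card J"
      using rank_le_card[OF l] card_vimage_Inl_Inr[OF finite_subset_ground[OF l] fin(1)] by simp
    moreover have "J \<in> indeps ?N \<longleftrightarrow> generic_rank F J = card J"
      using J Suc.IH by simp
    ultimately show ?thesis
      using fin pJ unfolding ins by (auto simp: generic_rank_def min_def split: if_splits)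
  qed
  have "I \<in> indeps (add_generic_points M F (Suc k)) \<longleftrightarrow>
      I \<subseteq> ground (add_generic_points M F (Suc k)) \<and> generic_rank F I = card I" for I
  proof (cases "?p \<in> I")
    case True
    then obtain J where J: "I = insert ?p J" "?p \<notin> J"
      by (meson mk_disjoint_insert)
    \<comment> \<open>Since \<open>?p\<close> is new, the set behind \<open>I\<close> in the
      definition of \<open>principal_extension\<close> must be \<open>J\<close>.\<close>
    have "J' = J" if "J' \<in> indeps ?N" "I = insert ?p J'" for J'
    proof -
      have "?p \<notin> J'"
        using that p N.indeps_eq by auto
      then show ?thesis
        using J that by (metis insert_ident)
    qed
    then have "I \<in> indeps (add_generic_points M F (Suc k)) \<longleftrightarrow>
        J \<in> indeps ?N \<and> \<not> ?F \<subseteq> mat_closure ?N J"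
      using True p J N.indeps_eq by (auto simp: principal_extension_def)
    moreover have "I \<subseteq> ground (add_generic_points M F (Suc k)) \<longleftrightarrow> J \<subseteq> ground ?N"
      using J by (auto simp: principal_extension_def)
    moreover have "J \<subseteq> ground ?N" if "J \<in> indeps ?N"
      using that N.indeps_eq by auto
    ultimately show ?thesis
      using key J by blast
  next
    case False
    then show ?thesis
      using Suc.IH by (auto simp: principal_extension_def)
  qed
  then show ?case
    by blast
qed

lemma ranked_matroid_add_generic_points:
  assumes "F \<subseteq> ground M"
  shows "ranked_matroid (add_generic_points M F k) (generic_rank F)"
  using ranked_matroid_generic[OF assms ground_add_generic_points indeps_add_generic_points[OF assms]] .

text \<open>
  Since \<open>k < r F\<close>, the generic points span a proper subflat of \<open>F\<close> that contains no old element.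
\<close>

lemma truncation_rank:
  assumes F: "F \<subseteq> ground M" and k: "k < r F" and loopless: "\<And>e. e \<in> ground M \<Longrightarrow> r {e} = 1"
  defines "N \<equiv> add_generic_points M F k"
  defines "T \<equiv> contraction N (mat_closure N (Inr ` {..<k}))"
  shows "ground T = Inl ` ground M"
    and "\<exists>\<rho>. ranked_matroid T \<rho> \<and> (\<forall>B\<subseteq>ground M. \<rho> (Inl ` B) = min (r B) (r (B \<union> F) - k))"
proof -
  let ?P = "Inr ` {..<k} :: ('a + nat) set"
  interpret N: ranked_matroid N "generic_rank F"
    unfolding N_def using F by (rule ranked_matroid_add_generic_points)
  have ground: "ground N = Inl ` ground M \<union> ?P"
    by (simp add: N_def ground_add_generic_points)
  have rank: "generic_rank F (Inl ` B \<union> ?P) = min (r B + k) (r (B \<union> F))" for B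
  proof -
    have "Inl -` (Inl ` B \<union> ?P) = B" "Inr -` (Inl ` B \<union> ?P) = {..<k}"
      by auto
    then show ?thesis
      by (simp add: generic_rank_def)
  qed
  have rankP: "generic_rank F ?P = k"
    using rank[of "{}"] k by simp
  have "mat_closure N ?P = ?P"
  proof -
    have "generic_rank F (insert (Inl e) ?P) \<noteq> k" if "e \<in> ground M" for e
    proof -
      have "r F \<le> r ({e} \<union> F)"
        using that F by (intro rank_mono) auto
      then show ?thesis
        using rank[of "{e}"] loopless[OF that] k by auto
    qed
    then show ?thesis
      using rankP by (auto simp: N.mat_closure_eq ground insert_absorb)
  qed
  then have T: "T = contraction N ?P"
    by (simp add: T_def)
  show "ground T = Inl ` ground M"
    by (auto simp: T contraction_def ground)
  have "ranked_matroid T (\<lambda>S. generic_rank F (S \<union> ?P) - generic_rank F ?P)"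
    unfolding T by (intro N.ranked_matroid_contraction) (simp add: ground)
  moreover have "generic_rank F (Inl ` B \<union> ?P) - generic_rank F ?P = min (r B) (r (B \<union> F) - k)" for B
    by (auto simp: rank rankP min_def)
  ultimately show "\<exists>\<rho>. ranked_matroid T \<rho> \<and>
      (\<forall>B\<subseteq>ground M. \<rho> (Inl ` B) = min (r B) (r (B \<union> F) - k))"
    by blast
qed

end

section \<open>The matroid of a central arrangement\<close>

lemma dim_plus_codim: "vec.dim X + codim X = CARD('n)" for X :: "(complex ^ 'n) set"
  using dim_subset_UNIV_cart_gen[of X] by (simp add: codim_def)

lemma codim_UNIV [simp]: "codim (UNIV :: (complex ^ 'n) set) = 0"
  using vec_dim_card[where 'n = 'n and 'a = complex] by (simp add: codim_def)

lemma codim_eq_0_iff: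
  assumes "vec.subspace X"
  shows "codim X = 0 \<longleftrightarrow> X = (UNIV :: (complex ^ 'n) set)"
proof
  assume "codim X = 0"
  then have "vec.dim (UNIV :: (complex ^ 'n) set) \<le> vec.dim X"
    using dim_plus_codim[of X] vec_dim_card[where 'n = 'n and 'a = complex] by simp
  then show "X = UNIV"
    using assms by (intro vec.subspace_dim_equal) auto
qed simp

lemma codim_sums_Int:
  fixes X Y :: "(complex ^ 'n) set"
  assumes "vec.subspace X" "vec.subspace Y"
  shows "codim {x + y | x y. x \<in> X \<and> y \<in> Y} + codim (X \<inter> Y) = codim X + codim Y"
  using vec.dim_sums_Int[OF assms] dim_plus_codim[of X] dim_plus_codim[of Y]
    dim_plus_codim[of "X \<inter> Y"] dim_plus_codim[of "{x + y | x y. x \<in> X \<and> y \<in> Y}"]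
  by linarith

lemma codim_antimono: "X \<subseteq> Y \<Longrightarrow> codim Y \<le> codim X"
  by (simp add: codim_def diff_le_mono2 vec.dim_subset)

lemma subset_sums:
  fixes X Y :: "(complex ^ 'n) set"
  assumes "vec.subspace X" "vec.subspace Y"
  shows "X \<subseteq> {x + y | x y. x \<in> X \<and> y \<in> Y}" "Y \<subseteq> {x + y | x y. x \<in> X \<and> y \<in> Y}"
  using vec.subspace_0[OF assms(1)] vec.subspace_0[OF assms(2)]
  by (auto, metis add.right_neutral, metis add.left_neutral)

lemma subspace_Inter_arrangement:
  assumes "central_arrangement \<A>" "\<B> \<subseteq> \<A>"
  shows "vec.subspace (\<Inter>\<B>)"
  using assms by (intro vec.subspace_Inter) (auto simp: central_arrangement_def)

text \<open>Submodularity is the dimension formula; it is only an inequality because the sum of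
  \<open>\<Inter>\<B>\<close> and \<open>\<Inter>\<C>\<close> may be properly contained in
  \<open>\<Inter>(\<B> \<inter> \<C>)\<close>. Adding hyperplanes one at a time then bounds the rank
  by the cardinality.\<close>

lemma ranked_matroid_arr_matroid:
  fixes \<A> :: "(complex ^ 'n) set set"
  assumes \<A>: "central_arrangement \<A>"
  shows "ranked_matroid (arr_matroid \<A>) (\<lambda>\<B>. codim (\<Inter>\<B>))"
proof -
  have submod: "codim (\<Inter>(\<B> \<union> \<C>)) + codim (\<Inter>(\<B> \<inter> \<C>)) \<le> codim (\<Inter>\<B>) + codim (\<Inter>\<C>)"
    if "\<B> \<subseteq> \<A>" "\<C> \<subseteq> \<A>" for \<B> \<C>
  proof -
    let ?P = "{x + y | x y. x \<in> \<Inter>\<B> \<and> y \<in> \<Inter>\<C>}"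
    have sub: "vec.subspace (\<Inter>\<B>)" "vec.subspace (\<Inter>\<C>)" "vec.subspace (\<Inter>(\<B> \<inter> \<C>))"
      using subspace_Inter_arrangement[OF \<A>] that by blast+
    have "?P \<subseteq> \<Inter>(\<B> \<inter> \<C>)"
    proof
      fix z assume "z \<in> ?P"
      then obtain x y where "z = x + y" "x \<in> \<Inter>\<B>" "y \<in> \<Inter>\<C>"
        by blast
      then show "z \<in> \<Inter>(\<B> \<inter> \<C>)"
        using vec.subspace_add[OF sub(3), of x y] by blast
    qed
    then have "codim (\<Inter>(\<B> \<inter> \<C>)) \<le> codim ?P"
      by (rule codim_antimono)
    moreover have "codim ?P + codim (\<Inter>\<B> \<inter> \<Inter>\<C>) = codim (\<Inter>\<B>) + codim (\<Inter>\<C>)"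
      using sub by (intro codim_sums_Int)
    ultimately show ?thesis
      by (simp add: Inter_Un_distrib)
  qed
  have card: "codim (\<Inter>\<B>) \<le> card \<B>" if "\<B> \<subseteq> \<A>" for \<B>
  proof -
    have "finite \<B>"
      using that \<A> finite_subset by (auto simp: central_arrangement_def)
    then show ?thesis
      using that
    proof (induction \<B>)
      case (insert H \<B>)
      have "codim (\<Inter>({H} \<union> \<B>)) \<le> codim (\<Inter>{H}) + codim (\<Inter>\<B>)"
        using submod[of "{H}" \<B>] insert.prems by auto
      moreover have "codim H = 1"
        using insert.prems \<A> by (auto simp: central_arrangement_def)
      ultimately show ?case
        using insert by simp
    qed simp
  qed
  show ?thesis
  proof
    show "finite (ground (arr_matroid \<A>))"
      using \<A> by (simp add: arr_matroid_def central_arrangement_def)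
    show "indeps (arr_matroid \<A>) = {\<B>. \<B> \<subseteq> ground (arr_matroid \<A>) \<and> codim (\<Inter>\<B>) = card \<B>}"
      using card by (auto simp: arr_matroid_def not_less dual_order.antisym)
  qed (use card submod in \<open>auto simp: arr_matroid_def intro!: codim_antimono\<close>)
qed

section \<open>Restriction to the span of a modular element and a generic vector\<close>

lemma span_insert_subspace:
  assumes "vec.subspace X"
  shows "vec.span (insert v X) = {t *s v + x | t x. x \<in> X}"
proof -
  have "y \<in> vec.span (insert v X) \<longleftrightarrow> (\<exists>t x. y = t *s v + x \<and> x \<in> X)" for y
  proof -
    have "y \<in> vec.span (insert v X) \<longleftrightarrow> (\<exists>t. y - t *s v \<in> X)"
      using assms by (simp add: vec.span_breakdown_eq vec.span_eq_iff[THEN iffD2])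
    also have "\<dots> \<longleftrightarrow> (\<exists>t x. y = t *s v + x \<and> x \<in> X)"
      by (metis add_diff_cancel_left' diff_add_cancel add.commute)
    finally show ?thesis .
  qed
  then show ?thesis
    by blast
qed

lemma dim_span_insert_subspace:
  assumes "vec.subspace X" "v \<notin> X"
  shows "vec.dim (vec.span (insert v X)) = Suc (vec.dim X)"
proof -
  have "v \<notin> vec.span X"
    using assms(2) by (subst vec.span_eq_iff[THEN iffD2, OF assms(1)])
  then show ?thesis
    by (simp add: vec.dim_insert)
qed

lemma subspace_scale_memD:
  fixes v :: "complex ^ 'n"
  assumes "vec.subspace H" "t *s v \<in> H" "v \<notin> H"
  shows "t = 0"
proof (rule ccontr)
  assume "t \<noteq> 0"
  then have "v = inverse t *s (t *s v)"
    by simp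
  then show False
    using assms vec.subspace_scale by metis
qed

text \<open>A hyperplane and one vector outside it span the whole space; \<open>c\<close> is the
  coordinate of \<open>y\<close> along \<open>x\<close>.\<close>

lemma exists_scale_diff_mem_hyperplane:
  fixes H :: "(complex ^ 'n) set"
  assumes "vec.subspace H" "codim H = 1" "x \<notin> H"
  shows "\<exists>c. y - c *s x \<in> H"
proof -
  have "codim (vec.span (insert x H)) = 0"
    using dim_span_insert_subspace[of H x] assms by (simp add: codim_def)
  then have "vec.span (insert x H) = UNIV"
    by (simp add: codim_eq_0_iff)
  then obtain c h where "y = c *s x + h" "h \<in> H"
    using span_insert_subspace[OF assms(1), of x] by blast
  then have "y - c *s x \<in> H"
    by simp
  then show ?thesis
    by blast
qed

text \<open>The sum always lies in the meet. Modularity and the dimension formula give both the same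
  codimension, hence equality. In particular \<open>X + Y\<close> is itself an intersection of
  members of \<open>\<A>\<close>.\<close>

lemma modular_meet_el:
  fixes \<A> :: "(complex ^ 'n) set set"
  assumes "central_arrangement \<A>" "modular_element \<A> X" "Y \<in> intersections UNIV \<A>"
  shows "meet_el \<A> X Y = {x + y | x y. x \<in> X \<and> y \<in> Y}" (is "_ = ?P")
proof -
  have sub: "vec.subspace X" "vec.subspace Y"
    using assms subspace_Inter_arrangement by (auto simp: modular_element_def intersections_def)
  have meet: "vec.subspace (meet_el \<A> X Y)"
    unfolding meet_el_def using assms(1) by (intro subspace_Inter_arrangement) auto
  have P: "vec.subspace ?P" "?P \<subseteq> meet_el \<A> X Y"
    using sub by (rule vec.subspace_sums) (unfold meet_el_def, blast)
  have "codim (meet_el \<A> X Y) = codim ?P"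
  proof -
    have "codim (X \<inter> Y) + codim (meet_el \<A> X Y) = codim X + codim Y"
      using assms by (simp add: modular_element_def join_el_def)
    then show ?thesis
      using codim_sums_Int[OF sub] by linarith
  qed
  then have "vec.dim (meet_el \<A> X Y) = vec.dim ?P"
    using dim_plus_codim[of "meet_el \<A> X Y"] dim_plus_codim[of ?P] by linarith
  then show ?thesis
    using vec.subspace_dim_equal[OF P(1) meet P(2)] by simp
qed

text \<open>
  By modularity, \<open>v\<close> lies in \<open>X + Y\<close> only if \<open>X + Y\<close> is the whole space; these two cases decide
  which of the two terms is the minimum.
\<close>

lemma codim_restriction_modular:
  fixes \<A> :: "(complex ^ 'n) set set"
  assumes \<A>: "central_arrangement \<A>" and mod: "modular_element \<A> X"
    and v: "\<And>H. H \<in> \<A> \<Longrightarrow> X \<subseteq> H \<Longrightarrow> v \<notin> H" and vX: "v \<notin> X"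
    and Y: "Y \<in> intersections UNIV \<A>"
  defines "W \<equiv> vec.span (insert v X)"
  shows "vec.dim W - vec.dim (W \<inter> Y) = min (codim Y) (codim (Y \<inter> X) - (codim X - 1))"
proof -
  let ?P = "{x + y | x y. x \<in> X \<and> y \<in> Y}"
  have sub: "vec.subspace X" "vec.subspace Y"
    using \<A> mod Y subspace_Inter_arrangement by (auto simp: modular_element_def intersections_def)
  \<comment> \<open>Positive codimension makes the subtraction in \<open>codim X - 1\<close> a
    genuine one.\<close>
  have X0: "codim X \<noteq> 0"
    using codim_eq_0_iff sub vX by blast
  have dimW: "vec.dim W = Suc (vec.dim X)"
    unfolding W_def using sub(1) vX by (rule dim_span_insert_subspace)
  have memW: "w \<in> W \<longleftrightarrow> (\<exists>t x. w = t *s v + x \<and> x \<in> X)" for w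
    unfolding W_def span_insert_subspace[OF sub(1)] by blast
  have sums: "codim ?P + codim (X \<inter> Y) = codim X + codim Y"
    using sub by (rule codim_sums_Int)
  note dims = dim_plus_codim[of X] dim_plus_codim[of Y] dim_plus_codim[of "X \<inter> Y"]
  show ?thesis
  proof (cases "?P = UNIV")
    case True
    then obtain x y where xy: "v = x + y" "x \<in> X" "y \<in> Y"
      by blast
    \<comment> \<open>\<open>v\<close> and \<open>y\<close> differ by an element of
      \<open>X\<close>, so \<open>y\<close> may replace \<open>v\<close> as a generator of
      \<open>W\<close>. As \<open>y\<close> lies in \<open>Y\<close>, the remaining part of a vector
      of \<open>W \<inter> Y\<close> lies in \<open>X \<inter> Y\<close>.\<close>
    have "W \<inter> Y = vec.span (insert y (X \<inter> Y))"
    proof -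
      have "w \<in> W \<inter> Y \<longleftrightarrow> (\<exists>t z. w = t *s y + z \<and> z \<in> X \<inter> Y)" for w
      proof
        assume "w \<in> W \<inter> Y"
        then obtain t x' where w: "w = t *s v + x'" "x' \<in> X" "w \<in> Y"
          using memW by blast
        then have eq: "w = t *s y + (t *s x + x')"
          by (simp add: xy(1) vec.scale_right_distrib)
        have "t *s x + x' \<in> X"
          using sub(1) xy w by (intro vec.subspace_add vec.subspace_scale)
        moreover have "w - t *s y \<in> Y"
          using sub(2) xy w by (intro vec.subspace_diff vec.subspace_scale)
        then have "t *s x + x' \<in> Y"
          using eq by (metis add_diff_cancel_left')
        ultimately show "\<exists>t z. w = t *s y + z \<and> z \<in> X \<inter> Y"
          using eq by blast
      next
        assume "\<exists>t z. w = t *s y + z \<and> z \<in> X \<inter> Y"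
        then obtain t z where w: "w = t *s y + z" "z \<in> X" "z \<in> Y"
          by blast
        then have "w = t *s v + (z - t *s x)"
          by (simp add: xy(1) vec.scale_right_distrib)
        moreover have "z - t *s x \<in> X"
          using sub(1) xy w by (intro vec.subspace_diff vec.subspace_scale)
        moreover have "w \<in> Y"
          unfolding w(1) using sub(2) xy w by (intro vec.subspace_add vec.subspace_scale)
        ultimately show "w \<in> W \<inter> Y"
          using memW by blast
      qed
      then show ?thesis
        unfolding span_insert_subspace[OF vec.subspace_inter[OF sub]] by blast
    qed
    moreover have "y \<notin> X \<inter> Y"
      using vX xy sub(1) vec.subspace_add by blast
    ultimately have "vec.dim (W \<inter> Y) = Suc (vec.dim (X \<inter> Y))"
      using dim_span_insert_subspace vec.subspace_inter[OF sub] by metis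
    moreover have "codim ?P = 0"
      unfolding True by simp
    \<comment> \<open>With \<open>codim ?P = 0\<close> the second term equals
      \<open>codim Y + 1\<close>, so the first is the minimum.\<close>
    ultimately show ?thesis
      using dimW sums dims X0 by (simp add: Int_commute min_def)
  next
    case False
    then have "codim ?P \<noteq> 0"
      using codim_eq_0_iff vec.subspace_sums[OF sub] by blast
    \<comment> \<open>Otherwise \<open>meet_el\<close> would be an empty intersection, hence the
      whole space, although it equals \<open>?P\<close>.\<close>
    have "\<exists>H\<in>\<A>. ?P \<subseteq> H"
    proof (rule ccontr)
      assume "\<not> ?thesis"
      then have "{H \<in> \<A>. ?P \<subseteq> H} = {}"
        by simp
      then have "meet_el \<A> X Y = UNIV"
        by (simp only: meet_el_def Inter_empty)
      then show False
        using False modular_meet_el[OF \<A> mod Y] by simp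
    qed
    then obtain H where H: "H \<in> \<A>" "X \<subseteq> H" "Y \<subseteq> H"
      using subset_sums[OF sub] by blast
    then have subH: "vec.subspace H"
      using \<A> by (auto simp: central_arrangement_def)
    \<comment> \<open>\<open>X\<close> and \<open>Y\<close> lie in \<open>H\<close> and
      \<open>v\<close> does not, so a vector of \<open>W\<close> that lies in \<open>Y\<close> has
      no component along \<open>v\<close>.\<close>
    have "W \<inter> Y = X \<inter> Y"
    proof (intro subset_antisym subsetI)
      fix w assume w: "w \<in> W \<inter> Y"
      then obtain t x where tx: "w = t *s v + x" "x \<in> X"
        using memW by blast
      have "w - x \<in> H"
        using w tx H subH by (intro vec.subspace_diff) auto
      then have "t *s v \<in> H"
        using tx by simp
      then have "t = 0"
        using subspace_scale_memD[OF subH] v[OF H(1,2)] by blast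
      then show "w \<in> X \<inter> Y"
        using w tx by simp
    next
      fix w assume "w \<in> X \<inter> Y"
      moreover have "w = 0 *s v + w"
        by simp
      ultimately show "w \<in> W \<inter> Y"
        using memW by blast
    qed
    then have "vec.dim W - vec.dim (W \<inter> Y) = codim (Y \<inter> X) - (codim X - 1)"
      using dimW dims X0 codim_antimono[of "X \<inter> Y" X] by (simp add: Int_commute)
    \<comment> \<open>Here \<open>codim ?P\<close> is at least 1, and the dimension formula bounds
      the second term by the first.\<close>
    moreover have "codim (Y \<inter> X) - (codim X - 1) \<le> codim Y"
      using \<open>codim ?P \<noteq> 0\<close> sums X0 by (simp add: Int_commute)
    ultimately show ?thesis
      by simp
  qed
qed

section \<open>The cone\<close>

definition cone_point :: "complex \<Rightarrow> complex ^ 'n \<Rightarrow> complex ^ 'n option" where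
  "cone_point t x = (\<chi> i. case i of None \<Rightarrow> t | Some j \<Rightarrow> x $ j)"

definition cone_proj :: "complex ^ 'n option \<Rightarrow> complex ^ 'n" where
  "cone_proj z = (\<chi> j. z $ Some j)"

lemma cone_proj_point [simp]: "cone_proj (cone_point t x) = x"
  by (simp add: cone_proj_def cone_point_def vec_eq_iff)

lemma cone_point_add: "cone_point s x + cone_point t y = cone_point (s + t) (x + y)"
  by (simp add: cone_point_def vec_eq_iff split: option.split)

lemma cone_point_diff: "cone_point s x - cone_point t y = cone_point (s - t) (x - y)"
  by (simp add: cone_point_def vec_eq_iff split: option.split)

lemma cone_point_scale: "c *s cone_point t x = cone_point (c * t) (c *s x)"
  by (simp add: cone_point_def vec_eq_iff split: option.split)

lemma cone_point_0: "cone_point 0 0 = 0"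
  by (simp add: cone_point_def vec_eq_iff split: option.split)

lemma at_height_eq: "at_height t K = cone_point t ` K"
  by (simp add: at_height_def cone_point_def[abs_def])

text \<open>All generators have height 1, so the coefficient of \<open>w\<close> in a linear
  combination is its height \<open>t\<close>.\<close>

lemma span_at_height:
  assumes U: "vec.subspace U"
  shows "vec.span (at_height 1 ((\<lambda>x. w + x) ` U)) = {cone_point t (t *s w + u) | t u. u \<in> U}"
    (is "vec.span ?G = ?V")
proof (rule vec.span_unique)
  show "?G \<subseteq> ?V"
  proof
    fix z assume "z \<in> ?G"
    then obtain u where u: "z = cone_point 1 (w + u)" "u \<in> U"
      by (auto simp: at_height_eq)
    then have "z = cone_point 1 (1 *s w + u)"
      by simp
    then show "z \<in> ?V"
      using u(2) by blast
  qed
  have 0: "0 \<in> ?V"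
  proof -
    have "cone_point 0 (0 *s w + 0) = 0"
      by (simp add: cone_point_0)
    then show ?thesis
      using vec.subspace_0[OF U] by (metis (mono_tags, lifting) mem_Collect_eq)
  qed
  have add: "a + b \<in> ?V" if ab: "a \<in> ?V" "b \<in> ?V" for a b
  proof -
    obtain s u t u' where "a = cone_point s (s *s w + u)" "b = cone_point t (t *s w + u')"
        "u \<in> U" "u' \<in> U"
      using ab by blast
    moreover then have "u + u' \<in> U"
      using U vec.subspace_add by blast
    moreover have "(s *s w + u) + (t *s w + u') = (s + t) *s w + (u + u')"
      by (simp add: vec.scale_left_distrib)
    ultimately show ?thesis
      using cone_point_add by (metis (mono_tags, lifting) mem_Collect_eq)
  qed
  have scale: "c *s a \<in> ?V" if a: "a \<in> ?V" for a c
  proof -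
    obtain s u where "a = cone_point s (s *s w + u)" "u \<in> U"
      using a by blast
    moreover then have "c *s u \<in> U"
      using U vec.subspace_scale by blast
    moreover have "c *s (s *s w + u) = (c * s) *s w + c *s u"
      by (simp add: vec.scale_right_distrib)
    ultimately show ?thesis
      using cone_point_scale by (metis (mono_tags, lifting) mem_Collect_eq)
  qed
  show "vec.subspace ?V"
    unfolding vec.subspace_def using 0 add scale by blast
next
  fix V' assume G: "?G \<subseteq> V'" and V': "vec.subspace V'"
  have gen: "cone_point 1 (w + u) \<in> V'" if "u \<in> U" for u
    using G that by (auto simp: at_height_eq)
  show "?V \<subseteq> V'"
  proof
    fix z assume "z \<in> ?V"
    then obtain t u where z: "z = cone_point t (t *s w + u)" "u \<in> U"
      by blast
    \<comment> \<open>The generator at \<open>w\<close> supplies the height; the difference of two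
      generators has height 0 and supplies \<open>u\<close>.\<close>
    have "z = t *s cone_point 1 (w + 0) + (cone_point 1 (w + u) - cone_point 1 (w + 0))"
      by (simp add: z cone_point_add cone_point_diff cone_point_scale)
    then show "z \<in> V'"
      using gen[OF z(2)] gen[OF vec.subspace_0[OF U]] V'
      by (simp only: vec.subspace_add vec.subspace_diff vec.subspace_scale)
  qed
qed

text \<open>As \<open>X\<close> is not inside \<open>H\<close>, \<open>v\<close> can be moved along
  \<open>X\<close> into \<open>H\<close>. From the new base point \<open>v + x\<close> the coset and
  its section are translates of \<open>X\<close> and \<open>H \<inter> X\<close> by one vector, as
  \<open>affine_hyperplane_of\<close> asks.\<close>

lemma affine_hyperplane_of_translate_Int:
  fixes X H :: "(complex ^ 'n) set"
  assumes X: "vec.subspace X" and H: "vec.subspace H" "codim H = 1" and XH: "\<not> X \<subseteq> H"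
  shows "\<exists>x. x \<in> X \<and> v + x \<in> H \<and> H \<inter> (\<lambda>x. v + x) ` X = (\<lambda>y. (v + x) + y) ` (H \<inter> X)"
    and "affine_hyperplane_of ((\<lambda>x. v + x) ` X) (H \<inter> (\<lambda>x. v + x) ` X)"
proof -
  obtain a where a: "a \<in> X" "a \<notin> H"
    using XH by blast
  obtain c where c: "v - c *s a \<in> H"
    using exists_scale_diff_mem_hyperplane[OF H a(2)] by blast
  define x where "x = - (c *s a)"
  have x: "x \<in> X" "v + x \<in> H"
    using a X c by (auto simp: x_def intro!: vec.subspace_neg vec.subspace_scale)
  have eq: "H \<inter> (\<lambda>x. v + x) ` X = (\<lambda>y. (v + x) + y) ` (H \<inter> X)"
  proof (intro subset_antisym subsetI)
    fix z assume "z \<in> H \<inter> (\<lambda>x. v + x) ` X"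
    then obtain y where y: "z = v + y" "y \<in> X" "z \<in> H"
      by blast
    have "z - (v + x) \<in> H"
      using H(1) y(3) x(2) by (rule vec.subspace_diff)
    moreover have "y - x \<in> X"
      using X y(2) x(1) by (rule vec.subspace_diff)
    moreover have "z - (v + x) = y - x" "z = (v + x) + (y - x)"
      using y by auto
    ultimately show "z \<in> (\<lambda>y. (v + x) + y) ` (H \<inter> X)"
      by (metis IntI image_eqI)
  next
    fix z assume "z \<in> (\<lambda>y. (v + x) + y) ` (H \<inter> X)"
    then obtain y where y: "z = (v + x) + y" "y \<in> H" "y \<in> X"
      by blast
    then have "z \<in> H"
      using vec.subspace_add[OF H(1) x(2)] by simp
    moreover have "x + y \<in> X" "z = v + (x + y)"
      using x(1) X y by (auto simp: add.assoc intro: vec.subspace_add)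
    ultimately show "z \<in> H \<inter> (\<lambda>x. v + x) ` X"
      by blast
  qed
  \<comment> \<open>Any \<open>a\<close> in \<open>X\<close> outside \<open>H\<close> spans a
    complement of \<open>H \<inter> X\<close> in \<open>X\<close>, so the dimensions differ by
    one.\<close>
  have "X = vec.span (insert a (H \<inter> X))"
  proof (intro subset_antisym subsetI)
    fix y assume "y \<in> X"
    obtain d where "y - d *s a \<in> H"
      using exists_scale_diff_mem_hyperplane[OF H a(2)] by blast
    moreover have "y - d *s a \<in> X"
      using \<open>y \<in> X\<close> a X by (intro vec.subspace_diff vec.subspace_scale)
    ultimately show "y \<in> vec.span (insert a (H \<inter> X))"
      unfolding vec.span_breakdown_eq using vec.span_base by blast
  next
    fix y assume "y \<in> vec.span (insert a (H \<inter> X))"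
    then show "y \<in> X"
      using vec.span_minimal[of "insert a (H \<inter> X)" X] a X by blast
  qed
  then have dim: "vec.dim X = vec.dim (H \<inter> X) + 1"
    using dim_span_insert_subspace[OF vec.subspace_inter[OF H(1) X], of a] a by simp
  have shift: "(\<lambda>x. v + x) ` X = (\<lambda>y. (v + x) + y) ` X"
  proof (intro subset_antisym subsetI)
    fix z assume "z \<in> (\<lambda>x. v + x) ` X"
    then obtain y where "z = v + y" "y \<in> X"
      by blast
    then have "z = (v + x) + (y - x)" "y - x \<in> X"
      using x X vec.subspace_diff by auto
    then show "z \<in> (\<lambda>y. (v + x) + y) ` X"
      by blast
  next
    fix z assume "z \<in> (\<lambda>y. (v + x) + y) ` X"
    then obtain y where "z = v + (x + y)" "y \<in> X"
      by (auto simp: add.assoc)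
    then show "z \<in> (\<lambda>x. v + x) ` X"
      using x X vec.subspace_add by blast
  qed
  show "\<exists>x. x \<in> X \<and> v + x \<in> H \<and> H \<inter> (\<lambda>x. v + x) ` X = (\<lambda>y. (v + x) + y) ` (H \<inter> X)"
    using x eq by blast
  show "affine_hyperplane_of ((\<lambda>x. v + x) ` X) (H \<inter> (\<lambda>x. v + x) ` X)"
    unfolding affine_hyperplane_of_def
    by (intro exI[of _ "v + x"] exI[of _ "H \<inter> X"] exI[of _ X])
      (use X H dim eq shift vec.subspace_inter in auto)
qed

section \<open>The cone over the restriction to a coset\<close>

context
  fixes X :: "(complex ^ 'n) set" and v :: "complex ^ 'n" and S V
  assumes X: "vec.subspace X" and vX: "v \<notin> X"
  defines "S \<equiv> (\<lambda>x. v + x) ` X"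
  defines "V \<equiv> cone_space S"
begin

lemma cone_space_eq: "V = {cone_point t (t *s v + x) | t x. x \<in> X}"
  unfolding V_def S_def cone_space_def using X by (rule span_at_height)

text \<open>Conditions on the cone space that involve only the projection can thus be tested in the
  span of \<open>v\<close> and \<open>X\<close>.\<close>

lemma cone_proj_cone_space: "cone_proj ` V = vec.span (insert v X)"
  unfolding cone_space_eq span_insert_subspace[OF X]
  by (force simp: image_iff)

text \<open>A point of \<open>V\<close> at height \<open>t\<close> projects to
  \<open>t *s v + x\<close>, which lies in \<open>H\<close> only for \<open>t = 0\<close>. So all
  hyperplanes containing \<open>X\<close> give the same hyperplane at infinity.\<close>

lemma cone_hyperplane_at_infinity:
  assumes H: "vec.subspace H" "X \<subseteq> H" "v \<notin> H"
  shows "at_height 0 (direction S) = V \<inter> cone_proj -` H"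
proof -
  have dir: "direction S = X"
  proof (intro subset_antisym subsetI)
    fix z assume "z \<in> direction S"
    then show "z \<in> X"
      using X vec.subspace_diff by (auto simp: direction_def S_def)
  next
    fix z assume z: "z \<in> X"
    have "v + z \<in> S" "v + 0 \<in> S"
      using z X vec.subspace_0 unfolding S_def by blast+
    moreover have "z = (v + z) - (v + 0)"
      by simp
    ultimately show "z \<in> direction S"
      unfolding direction_def by blast
  qed
  have mem: "t *s v + x \<in> H \<longleftrightarrow> t = 0" if "x \<in> X" for t x
  proof
    assume "t *s v + x \<in> H"
    moreover have "x \<in> H"
      using that H by blast
    ultimately have "(t *s v + x) - x \<in> H"
      using H vec.subspace_diff by blast
    then have "t *s v \<in> H"
      by simp
    then show "t = 0"
      using subspace_scale_memD[OF H(1)] H(3) by blast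
  qed (use that H in auto)
  have "V \<inter> cone_proj -` H = {cone_point t (t *s v + x) | t x. x \<in> X \<and> t *s v + x \<in> H}"
    unfolding cone_space_eq by (auto, blast)
  then have "V \<inter> cone_proj -` H = {cone_point t (t *s v + x) | t x. x \<in> X \<and> t = 0}"
    using mem by blast
  then show ?thesis
    unfolding dir at_height_eq by auto
qed

text \<open>After the base point is changed from \<open>v\<close> to a point \<open>v + x\<close> of
  \<open>H\<close>, a vector \<open>t *s (v + x) + u\<close> lies in \<open>H\<close> if and only if
  \<open>u\<close> does.\<close>

lemma cone_hyperplane:
  assumes H: "vec.subspace H" "codim H = 1" "\<not> X \<subseteq> H"
  shows "vec.span (at_height 1 (H \<inter> S)) = V \<inter> cone_proj -` H"
proof -
  obtain x where x: "x \<in> X" "v + x \<in> H" and eq: "H \<inter> S = (\<lambda>y. (v + x) + y) ` (H \<inter> X)"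
    using affine_hyperplane_of_translate_Int(1)[OF X H, of v, folded S_def] by blast
  have HX: "vec.subspace (H \<inter> X)"
    using H X by (intro vec.subspace_inter)
  have "vec.span (at_height 1 (H \<inter> S)) = {cone_point t (t *s (v + x) + u) | t u. u \<in> H \<inter> X}"
    unfolding eq using HX by (rule span_at_height)
  also have "\<dots> = V \<inter> cone_proj -` H"
  proof (intro subset_antisym subsetI)
    fix z assume "z \<in> {cone_point t (t *s (v + x) + u) | t u. u \<in> H \<inter> X}"
    then obtain t u where z: "z = cone_point t (t *s (v + x) + u)" "u \<in> H" "u \<in> X"
      by blast
    have "t *s (v + x) + u \<in> H"
      using vec.subspace_add[OF H(1) vec.subspace_scale[OF H(1) x(2)] z(2)] .
    moreover have "t *s x + u \<in> X"
      using X x(1) z(3) by (intro vec.subspace_add vec.subspace_scale)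
    moreover have "z = cone_point t (t *s v + (t *s x + u))"
      by (simp add: z vec.scale_right_distrib add.assoc)
    ultimately show "z \<in> V \<inter> cone_proj -` H"
      unfolding cone_space_eq using z by (auto simp: vec.scale_right_distrib add.assoc)
  next
    fix z assume "z \<in> V \<inter> cone_proj -` H"
    then obtain t y where z: "z = cone_point t (t *s v + y)" "y \<in> X" "t *s v + y \<in> H"
      unfolding cone_space_eq by auto
    have "(t *s v + y) - t *s (v + x) \<in> H"
      using vec.subspace_diff[OF H(1) z(3) vec.subspace_scale[OF H(1) x(2)]] .
    moreover have "y - t *s x \<in> X"
      using X x(1) z(2) by (intro vec.subspace_diff vec.subspace_scale)
    moreover have "(t *s v + y) - t *s (v + x) = y - t *s x"
      by (simp add: vec.scale_right_distrib)
    moreover have "z = cone_point t (t *s (v + x) + (y - t *s x))"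
      by (simp add: z vec.scale_right_distrib)
    ultimately show "z \<in> {cone_point t (t *s (v + x) + u) | t u. u \<in> H \<inter> X}"
      by (metis (mono_tags, lifting) IntI mem_Collect_eq)
  qed
  finally show ?thesis .
qed

lemma restriction_translate_eq:
  assumes \<A>: "central_arrangement \<A>" and v: "\<And>H. H \<in> \<A> \<Longrightarrow> X \<subseteq> H \<Longrightarrow> v \<notin> H"
  shows "restriction \<A> S = (\<lambda>H. H \<inter> S) ` {H \<in> \<A>. \<not> X \<subseteq> H}"
proof -
  have "affine_hyperplane_of S (H \<inter> S) \<longleftrightarrow> \<not> X \<subseteq> H" if H: "H \<in> \<A>" for H
  proof
    assume "affine_hyperplane_of S (H \<inter> S)"
    then obtain w U where "vec.subspace U" "H \<inter> S = (\<lambda>x. w + x) ` U"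
      unfolding affine_hyperplane_of_def by blast
    \<comment> \<open>\<open>0 \<in> U\<close> makes an affine hyperplane nonempty, whereas an
      \<open>H\<close> containing \<open>X\<close> misses \<open>S\<close>: a common point
      \<open>v + x\<close> would put \<open>v\<close> in \<open>H\<close>.\<close>
    then have "H \<inter> S \<noteq> {}"
      using vec.subspace_0 by blast
    then obtain x where x: "x \<in> X" "v + x \<in> H"
      by (auto simp: S_def)
    show "\<not> X \<subseteq> H"
    proof
      assume "X \<subseteq> H"
      then have "(v + x) - x \<in> H"
        using x H \<A> by (intro vec.subspace_diff) (auto simp: central_arrangement_def)
      then show False
        using v[OF H \<open>X \<subseteq> H\<close>] by simp
    qed
  next
    assume "\<not> X \<subseteq> H"
    then show "affine_hyperplane_of S (H \<inter> S)"
      using affine_hyperplane_of_translate_Int(2)[OF X, of H v] H \<A>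
      unfolding S_def central_arrangement_def by blast
  qed
  then show ?thesis
    by (auto simp: restriction_def)
qed

text \<open>The cone always adjoins the hyperplane at infinity; \<open>H\<^sub>0\<close> ensures
  that it also arises from a member of \<open>\<A>\<close>.\<close>

lemma arr_cone_restriction_eq:
  assumes \<A>: "central_arrangement \<A>" and v: "\<And>H. H \<in> \<A> \<Longrightarrow> X \<subseteq> H \<Longrightarrow> v \<notin> H"
    and ex: "H\<^sub>0 \<in> \<A>" "X \<subseteq> H\<^sub>0"
  shows "arr_cone S (restriction \<A> S) = (\<lambda>H. V \<inter> cone_proj -` H) ` \<A>"
proof -
  have inf: "at_height 0 (direction S) = V \<inter> cone_proj -` H" if "H \<in> \<A>" "X \<subseteq> H" for H
    using that v \<A> by (intro cone_hyperplane_at_infinity) (auto simp: central_arrangement_def)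
  have fin: "vec.span (at_height 1 (H \<inter> S)) = V \<inter> cone_proj -` H" if "H \<in> \<A>" "\<not> X \<subseteq> H" for H
    using that \<A> by (intro cone_hyperplane) (auto simp: central_arrangement_def)
  have "arr_cone S (restriction \<A> S) = insert (at_height 0 (direction S))
      ((\<lambda>H. vec.span (at_height 1 (H \<inter> S))) ` {H \<in> \<A>. \<not> X \<subseteq> H})"
    unfolding arr_cone_def using restriction_translate_eq[OF \<A> v] by (simp add: image_image)
  also have "\<dots> = insert (at_height 0 (direction S))
      ((\<lambda>H. V \<inter> cone_proj -` H) ` {H \<in> \<A>. \<not> X \<subseteq> H})"
    using fin by (intro arg_cong2[where f = insert] image_cong) auto
  also have "\<dots> = (\<lambda>H. V \<inter> cone_proj -` H) ` {H \<in> \<A>. X \<subseteq> H}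
      \<union> (\<lambda>H. V \<inter> cone_proj -` H) ` {H \<in> \<A>. \<not> X \<subseteq> H}"
  proof -
    have "(\<lambda>H. V \<inter> cone_proj -` H) ` {H \<in> \<A>. X \<subseteq> H}
        = (\<lambda>H. at_height 0 (direction S)) ` {H \<in> \<A>. X \<subseteq> H}"
      using inf[symmetric] by (intro image_cong refl) blast
    also have "\<dots> = {at_height 0 (direction S)}"
      using ex by auto
    finally show ?thesis
      by simp
  qed
  also have "\<dots> = (\<lambda>H. V \<inter> cone_proj -` H) ` \<A>"
    by blast
  finally show ?thesis .
qed

end

section \<open>Lattices of intersections and of flats\<close>

lemma order_isomorphic_trans:
  assumes "order_isomorphic A le B le'" "order_isomorphic B le' C le''"
  shows "order_isomorphic A le C le''"
proof -
  obtain f g where "bij_betw f A B" "\<forall>x\<in>A. \<forall>y\<in>A. le x y \<longleftrightarrow> le' (f x) (f y)"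
      "bij_betw g B C" "\<forall>x\<in>B. \<forall>y\<in>B. le' x y \<longleftrightarrow> le'' (g x) (g y)"
    using assms unfolding order_isomorphic_def by blast
  then show ?thesis
    unfolding order_isomorphic_def
    by (intro exI[of _ "g \<circ> f"]) (auto intro: bij_betw_trans simp: bij_betwE)
qed

text \<open>A Galois connection: \<open>Y\<close> corresponds to the set of all indices
  \<open>a\<close> whose \<open>g a\<close> contains it. Index sets are used because distinct
  indices may give the same member, as the hyperplanes containing \<open>X\<close> do.\<close>

lemma intersections_image_isomorphic:
  "order_isomorphic (intersections V ((\<lambda>a. V \<inter> g a) ` A)) (\<lambda>Y Z. Z \<subseteq> Y)
     {B. B \<subseteq> A \<and> (\<forall>a\<in>A. V \<inter> \<Inter>(g ` B) \<subseteq> g a \<longrightarrow> a \<in> B)} (\<subseteq>)"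
    (is "order_isomorphic ?L _ ?C _")
proof -
  define f where "f Y = {a \<in> A. Y \<subseteq> g a}" for Y
  have L: "?L = {V \<inter> \<Inter>(g ` B) | B. B \<subseteq> A}"
  proof -
    have "?L = {V \<inter> \<Inter>((\<lambda>a. V \<inter> g a) ` B) | B. B \<subseteq> A}"
      unfolding intersections_def subset_image_iff by blast
    moreover have "V \<inter> \<Inter>((\<lambda>a. V \<inter> g a) ` B) = V \<inter> \<Inter>(g ` B)" for B
      by auto
    ultimately show ?thesis
      by simp
  qed
  have inv: "V \<inter> \<Inter>(g ` f Y) = Y" if "Y \<in> ?L" for Y
  proof -
    obtain B where B: "B \<subseteq> A" "Y = V \<inter> \<Inter>(g ` B)"
      using \<open>Y \<in> ?L\<close> unfolding L by blast
    then have "B \<subseteq> f Y"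
      by (auto simp: f_def)
    then show ?thesis
      using B(2) by (auto simp: f_def)
  qed
  have "bij_betw f ?L ?C"
  proof (rule bij_betw_byWitness[where f' = "\<lambda>B. V \<inter> \<Inter>(g ` B)"])
    show "\<forall>Y\<in>?L. V \<inter> \<Inter>(g ` f Y) = Y"
      using inv by blast
    show "\<forall>B\<in>?C. f (V \<inter> \<Inter>(g ` B)) = B"
      by (auto simp: f_def)
    show "f ` ?L \<subseteq> ?C"
      using inv by (auto simp: f_def)
    show "(\<lambda>B. V \<inter> \<Inter>(g ` B)) ` ?C \<subseteq> ?L"
      unfolding L by blast
  qed
  moreover have "Z \<subseteq> Y \<longleftrightarrow> f Y \<subseteq> f Z" if "Y \<in> ?L" "Z \<in> ?L" for Y Z
  proof
    assume "f Y \<subseteq> f Z"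
    then have "V \<inter> \<Inter>(g ` f Z) \<subseteq> V \<inter> \<Inter>(g ` f Y)"
      by blast
    then show "Z \<subseteq> Y"
      using inv that by simp
  qed (auto simp: f_def)
  ultimately show ?thesis
    unfolding order_isomorphic_def by blast
qed

theorem theorem2p4:
  fixes \<A> :: "(complex ^ 'n) set set" and X :: "(complex ^ 'n) set" and v :: "complex ^ 'n"
  assumes "central_arrangement \<A>"
    and "modular_element \<A> X"
    and "X \<noteq> UNIV"
    and "quot_proj X v \<in> range (quot_proj X) - \<Union>(quot_localization \<A> X)"
  defines "S \<equiv> quot_proj X -` {quot_proj X v}"
  shows "order_isomorphic
           (intersections (cone_space S) (arr_cone S (restriction \<A> S))) (\<lambda>Y Z. Z \<subseteq> Y)
           (flats (complete_principal_truncation (arr_matroid \<A>) (localization \<A> X))) (\<subseteq>)"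
proof -
  note \<A> = assms(1) and mod = assms(2)
  obtain \<B> where \<B>: "\<B> \<subseteq> \<A>" "X = \<Inter>\<B>"
    using mod by (auto simp: modular_element_def intersections_def)
  have X: "vec.subspace X"
    unfolding \<B>(2) using \<A> \<B>(1) by (rule subspace_Inter_arrangement)
  have v: "v \<notin> H" if "H \<in> \<A>" "X \<subseteq> H" for H
    using assms(4) that by (auto simp: quot_localization_def localization_def)
  \<comment> \<open>\<open>X\<close> is a proper subspace, so the family \<open>\<B>\<close> is
    nonempty, and any member of it contains \<open>X\<close>.\<close>
  obtain H\<^sub>0 where H0: "H\<^sub>0 \<in> \<A>" "X \<subseteq> H\<^sub>0"
    using assms(3) \<B> by blast
  have vX: "v \<notin> X"
    using v[OF H0] H0 by blast
  have S: "S = (\<lambda>x. v + x) ` X"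
  proof -
    have "quot_proj X w = quot_proj X v \<longleftrightarrow> w \<in> quot_proj X v" for w
    proof
      assume "quot_proj X w = quot_proj X v"
      moreover have "w + 0 \<in> quot_proj X w"
        unfolding quot_proj_def using vec.subspace_0[OF X] by blast
      ultimately show "w \<in> quot_proj X v"
        by simp
    next
      assume "w \<in> quot_proj X v"
      then obtain x where x: "w = v + x" "x \<in> X"
        by (auto simp: quot_proj_def)
      have "v + x + y \<in> (\<lambda>x. v + x) ` X" "v + y \<in> (\<lambda>y. v + x + y) ` X" if "y \<in> X" for y
      proof -
        have "x + y \<in> X" "y - x \<in> X"
          using x that X by (auto intro: vec.subspace_add vec.subspace_diff)
        moreover have "v + x + y = v + (x + y)" "v + y = v + x + (y - x)"
          by auto
        ultimately show "v + x + y \<in> (\<lambda>x. v + x) ` X" "v + y \<in> (\<lambda>y. v + x + y) ` X"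
          by (metis image_eqI)+
      qed
      then show "quot_proj X w = quot_proj X v"
        unfolding quot_proj_def x(1) by blast
    qed
    then show ?thesis
      unfolding S_def by (auto simp: quot_proj_def)
  qed
  define V where "V = cone_space S"
  define W where "W = vec.span (insert v X)"
  let ?F = "localization \<A> X" and ?G = "arr_matroid \<A>"
  have cone: "arr_cone S (restriction \<A> S) = (\<lambda>H. V \<inter> cone_proj -` H) ` \<A>"
    unfolding V_def S by (rule arr_cone_restriction_eq[OF X vX \<A> v H0])
  have projV: "cone_proj ` V = W"
    unfolding V_def W_def S by (rule cone_proj_cone_space[OF X vX])
  have InterF: "\<Inter>?F = X"
    unfolding localization_def using \<B> by blast
  interpret G: ranked_matroid ?G "\<lambda>\<B>. codim (\<Inter>\<B>)"
    using \<A> by (rule ranked_matroid_arr_matroid)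
  have ground: "ground ?G = \<A>"
    by (simp add: arr_matroid_def)
  have F: "?F \<subseteq> ground ?G"
    by (auto simp: ground localization_def)
  define k where "k = mat_rank ?G ?F - 1"
  have k: "k = codim X - 1"
    unfolding k_def using G.mat_rank_eq[OF F] InterF by simp
  \<comment> \<open>\<open>X\<close> has positive codimension, so the off-by-one in \<open>k\<close>
    yields the strict bound that \<open>truncation_rank\<close> asks for.\<close>
  then have kF: "k < codim (\<Inter>?F)"
    using codim_eq_0_iff[OF X] assms(3) InterF by simp
  have loopless: "codim (\<Inter>{H}) = 1" if "H \<in> ground ?G" for H
    using that \<A> by (auto simp: ground central_arrangement_def)
  define N where "N = add_generic_points ?G ?F k"
  define T where "T = contraction N (mat_closure N (Inr ` {..<k}))"
  have cpt: "complete_principal_truncation ?G ?F = simplification T"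
    by (simp add: complete_principal_truncation_def Let_def T_def N_def k_def)
  have groundT: "ground T = Inl ` \<A>"
    using G.truncation_rank(1)[OF F kF loopless] by (simp add: T_def N_def ground)
  obtain \<rho> where \<rho>: "ranked_matroid T \<rho>" and
    \<rho>_eq: "\<And>\<C>. \<C> \<subseteq> \<A> \<Longrightarrow> \<rho> (Inl ` \<C>) = min (codim (\<Inter>\<C>)) (codim (\<Inter>(\<C> \<union> ?F)) - k)"
    using G.truncation_rank(2)[OF F kF loopless] unfolding T_def N_def ground by blast
  interpret T: ranked_matroid T \<rho>
    by (rule \<rho>)
  \<comment> \<open>Modularity enters here: it identifies the rank of the truncation with
    codimension inside \<open>W\<close>.\<close>
  have \<rho>_dim: "\<rho> (Inl ` \<C>) = vec.dim W - vec.dim (W \<inter> \<Inter>\<C>)" if "\<C> \<subseteq> \<A>" for \<C>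
  proof -
    have "\<Inter>\<C> \<in> intersections UNIV \<A>"
      using that by (auto simp: intersections_def)
    then have "vec.dim W - vec.dim (W \<inter> \<Inter>\<C>)
        = min (codim (\<Inter>\<C>)) (codim (\<Inter>\<C> \<inter> X) - (codim X - 1))"
      unfolding W_def using codim_restriction_modular[OF \<A> mod v vX] by blast
    then show ?thesis
      using \<rho>_eq[OF that] by (simp add: Inter_Un_distrib InterF k)
  qed
  \<comment> \<open>Equal ranks mean equal dimensions of nested subspaces of \<open>W\<close>, hence
    equal subspaces. The right-hand side is the closedness condition of
    \<open>intersections_image_isomorphic\<close>.\<close>
  have closed: "\<rho> (insert (Inl H) (Inl ` \<C>)) = \<rho> (Inl ` \<C>) \<longleftrightarrow>
      V \<inter> \<Inter>((\<lambda>H. cone_proj -` H) ` \<C>) \<subseteq> cone_proj -` H" if "\<C> \<subseteq> \<A>" "H \<in> \<A>" for \<C> H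
  proof -
    have sub: "vec.subspace (W \<inter> \<Inter>\<C>)" "vec.subspace (W \<inter> \<Inter>(insert H \<C>))"
      unfolding W_def using that
      by (auto simp only: intro!: vec.subspace_inter vec.subspace_span
          subspace_Inter_arrangement[OF \<A>])
    have "vec.dim (W \<inter> \<Inter>\<C>) \<le> vec.dim W" "vec.dim (W \<inter> \<Inter>(insert H \<C>)) \<le> vec.dim W"
      by (intro vec.dim_subset; blast)+
    moreover have "\<rho> (insert (Inl H) (Inl ` \<C>)) = vec.dim W - vec.dim (W \<inter> \<Inter>(insert H \<C>))"
      using \<rho>_dim[of "insert H \<C>"] that by simp
    ultimately have "\<rho> (insert (Inl H) (Inl ` \<C>)) = \<rho> (Inl ` \<C>) \<longleftrightarrow>
        vec.dim (W \<inter> \<Inter>(insert H \<C>)) = vec.dim (W \<inter> \<Inter>\<C>)"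
      using \<rho>_dim[OF that(1)] by auto
    also have "\<dots> \<longleftrightarrow> W \<inter> \<Inter>(insert H \<C>) = W \<inter> \<Inter>\<C>"
    proof
      assume "vec.dim (W \<inter> \<Inter>(insert H \<C>)) = vec.dim (W \<inter> \<Inter>\<C>)"
      then show "W \<inter> \<Inter>(insert H \<C>) = W \<inter> \<Inter>\<C>"
        by (intro vec.subspace_dim_equal sub) auto
    qed simp
    also have "\<dots> \<longleftrightarrow> W \<inter> \<Inter>\<C> \<subseteq> H"
      by auto
    also have "\<dots> \<longleftrightarrow> V \<inter> \<Inter>((\<lambda>H. cone_proj -` H) ` \<C>) \<subseteq> cone_proj -` H"
      unfolding projV[symmetric] by blast
    finally show ?thesis .
  qed
  let ?C = "{\<C>. \<C> \<subseteq> \<A> \<and>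
      (\<forall>H\<in>\<A>. V \<inter> \<Inter>((\<lambda>H. cone_proj -` H) ` \<C>) \<subseteq> cone_proj -` H \<longrightarrow> H \<in> \<C>)}"
  let ?I = "\<lambda>\<C>. Inl ` \<C> :: ((complex ^ 'n) set + nat) set"
  \<comment> \<open>Every element of \<open>T\<close> is an \<open>Inl\<close> image, so a flat
    comes from a set of hyperplanes, and \<open>closed\<close> turns its defining condition into
    that of \<open>?C\<close>.\<close>
  have flatsT: "flats T = ?I ` ?C"
  proof -
    have flat_iff: "Inl ` \<C> \<in> flats T \<longleftrightarrow> \<C> \<in> ?C" if "\<C> \<subseteq> \<A>" for \<C>
    proof -
      have "Inl ` \<C> \<in> flats T \<longleftrightarrow>
          (\<forall>H\<in>\<A>. \<rho> (insert (Inl H) (Inl ` \<C>)) = \<rho> (Inl ` \<C>) \<longrightarrow> H \<in> \<C>)"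
        unfolding T.mem_flats_iff groundT using that by (simp add: image_mono inj_image_mem_iff)
      then show ?thesis
        using that closed[OF that] by simp
    qed
    show ?thesis
    proof (intro subset_antisym subsetI)
      fix E assume E: "E \<in> flats T"
      then obtain \<C> where "\<C> \<subseteq> \<A>" "E = Inl ` \<C>"
        unfolding T.mem_flats_iff groundT subset_image_iff by blast
      then show "E \<in> ?I ` ?C"
        using E flat_iff by (metis (no_types, lifting) image_eqI)
    next
      fix E assume "E \<in> ?I ` ?C"
      then obtain \<C> where "\<C> \<in> ?C" "E = Inl ` \<C>"
        by (rule imageE)
      then show "E \<in> flats T"
        using flat_iff[of \<C>] by simp
    qed
  qed
  have "order_isomorphic (intersections V ((\<lambda>H. V \<inter> cone_proj -` H) ` \<A>)) (\<lambda>Y Z. Z \<subseteq> Y) ?C (\<subseteq>)"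
    by (rule intersections_image_isomorphic)
  moreover have "order_isomorphic ?C (\<subseteq>) (flats T) (\<subseteq>)"
  proof -
    have "bij_betw ?I ?C (flats T)"
      unfolding bij_betw_def using flatsT by (simp add: inj_on_def inj_image_eq_iff)
    then show ?thesis
      unfolding order_isomorphic_def by (intro exI[of _ ?I]) (simp add: inj_image_subset_iff)
  qed
  moreover have "order_isomorphic (flats T) (\<subseteq>) (flats (simplification T)) (\<subseteq>)"
    by (rule T.flats_simplification_isomorphic)
  ultimately show ?thesis
    unfolding cone cpt V_def[symmetric] by (rule order_isomorphic_trans[OF order_isomorphic_trans])
qed

end
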